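(* A map $f:\mathscr{C}\to\mathscr{B}$ of $C^\infty$-rings induces a unique map $$\Lambda^\bullet(f):\Lambda^\bullet\Omega^1_{\mathscr{C}}\to\Lambda^\bullet\Omega^1_{\mathscr{B}}$$ of commutative differential graded algebras. Explicitly, $$\Lambda^\bullet(f)\big(a_0\,d_{\mathscr{C}}a_1\wedge\cdots\wedge d_{\mathscr{C}}a_k\big)=f(a_0)\,d_{\mathscr{B}}f(a_1)\wedge\cdots\wedge d_{\mathscr{B}}f(a_k)$$ for all $k>0$ and all $a_0,\ldots,a_k\in\mathscr{C}$.
   Context: A $C^\infty$-ring is a nonempty set $\mathscr{C}$ with, for every $m\ge 0$ and every $g\in C^\infty(\mathbb{R}^m)$, an operation $g_{\mathscr{C}}:\mathscr{C}^m\to\mathscr{C}$, such that coordinate functions act as projections and the operations are compatible with composition of smooth functions; a map of $C^\infty$-rings is a map of sets preserving all operations. Every $C^\infty$-ring has an underlying commutative unital $\mathbb{R}$-algebra, and a module over $\mathscr{C}$ is a module over this algebra. A $C^\infty$-derivation of $\mathscr{C}$ with values in a $\mathscr{C}$-module $\mathscr{M}$ is a map $X:\mathscr{C}\to\mathscr{M}$ with $X(h_{\mathscr{C}}(a_1,\ldots,a_n))=\sum_{i}(\partial_i h)_{\mathscr{C}}(a_1,\ldots,a_n)\cdot X(a_i)$ for all $n>0$, $h\in C^\infty(\mathbb{R}^n)$, $a_i\in\mathscr{C}$. $d_{\mathscr{C}}:\mathscr{C}\to\Omega^1_{\mathscr{C}}$ denotes the universal $C^\infty$-derivation: every $C^\infty$-derivation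 $X:\mathscr{C}\to\mathscr{N}$ factors as $X=\varphi_X\circ d_{\mathscr{C}}$ for a unique $\mathscr{C}$-linear $\varphi_X:\Omega^1_{\mathscr{C}}\to\mathscr{N}$. It exists for every $\mathscr{C}$. $\Lambda^\bullet\Omega^1_{\mathscr{C}}=\{\Lambda^k\Omega^1_{\mathscr{C}}\}_{k\in\mathbb{Z}}$ are the exterior powers over $\mathscr{C}$ ($\Lambda^0=\mathscr{C}$, $\Lambda^k=0$ for $k<0$), with the wedge product and with the unique degree $+1$ graded derivation $d$ extending $d_{\mathscr{C}}$ and satisfying $d\circ d=0$; thus $d(a\,d_{\mathscr{C}}b_1\wedge\cdots\wedge d_{\mathscr{C}}b_k)=d_{\mathscr{C}}a\wedge d_{\mathscr{C}}b_1\wedge\cdots\wedge d_{\mathscr{C}}b_k$. This is a commutative differential graded algebra (CDGA) over $\mathscr{C}$: a sequence of $\mathscr{C}$-modules with a $\mathscr{C}$-bilinear associative graded-commutative product and a degree $+1$ graded derivation ($\mathbb{R}$-linear) of square zero. A map of CDGAs from $(\mathscr{C}_1,\mathscr{M}_1^\bullet)$ to $(\mathscr{C}_2,\mathscr{M}_2^\bullet)$ is a pair $(\varphi,\{f^k\}_{k\in\mathbb{Z}})$ with $\varphi:\mathscr{C}_1\to\mathscr{C}_2$ a map of $C^\infty$-rings and $f^k:\mathscr{M}_1^k\to\mathscr{M}_2^k$ additive maps with $f^k(r\cdot m)=\varphi(r)\cdot f^k(m)$, preserving products and commuting with differentials.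
   Formalization: Uniqueness is stated among maps over f whose degree 0 component sends 1 to 1; without this condition the zero maps in all degrees would be a second map of commutative differential graded algebras over f whenever B is nonzero. *)

theory Defs
  imports "HOL-Analysis.Analysis" "HOL-Algebra.Module"
begin

section \<open>Smooth functions of m variables\<close>

text \<open>
  The arity m has to be a term, so a function on \<open>\<real>\<^sup>m\<close> is represented by a function of sequences
  that depends only on the entries with index less than m.  On such functions, continuity for the
  product topology of \<^typ>\<open>nat \<Rightarrow> real\<close> is continuity on \<open>\<real>\<^sup>m\<close>, and the representation is
  one-to-one.
\<close>

definition pd :: "nat \<Rightarrow> ((nat \<Rightarrow> real) \<Rightarrow> real) \<Rightarrow> (nat \<Rightarrow> real) \<Rightarrow> real" where
  "pd i g = (\<lambda>x. deriv (\<lambda>t. g (x(i := t))) (x i))"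

definition Cinf :: "nat \<Rightarrow> ((nat \<Rightarrow> real) \<Rightarrow> real) set" where
  "Cinf m = {g.
     (\<forall>x y. (\<forall>i<m. x i = y i) \<longrightarrow> g x = g y) \<and>
     (\<forall>js. set js \<subseteq> {..<m} \<longrightarrow>
        continuous_on UNIV (foldr pd js g) \<and>
        (\<forall>i<m. \<forall>x. (\<lambda>t. foldr pd js g (x(i := t))) differentiable (at (x i))))}"

section \<open>Smooth rings\<close>

record 'a cinf_ring = "'a partial_object" +
  cinf_op :: "nat \<Rightarrow> ((nat \<Rightarrow> real) \<Rightarrow> real) \<Rightarrow> 'a list \<Rightarrow> 'a"

locale cinf_ring =
  fixes C :: "'a cinf_ring"
  assumes nonempty: "carrier C \<noteq> {}"
    and op_closed: "\<And>m g xs. \<lbrakk>g \<in> Cinf m; set xs \<subseteq> carrier C; length xs = m\<rbrakk>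
      \<Longrightarrow> cinf_op C m g xs \<in> carrier C"
    and op_proj: "\<And>m i xs. \<lbrakk>i < m; set xs \<subseteq> carrier C; length xs = m\<rbrakk>
      \<Longrightarrow> cinf_op C m (\<lambda>x. x i) xs = xs ! i"
    and op_comp: "\<And>n m g hs xs.
      \<lbrakk>g \<in> Cinf n; set hs \<subseteq> Cinf m; length hs = n; set xs \<subseteq> carrier C; length xs = m\<rbrakk>
      \<Longrightarrow> cinf_op C n g (map (\<lambda>h. cinf_op C m h xs) hs) =
          cinf_op C m (\<lambda>x. g (\<lambda>i. if i < n then (hs ! i) x else 0)) xs"

definition cinf_hom :: "'a cinf_ring \<Rightarrow> 'b cinf_ring \<Rightarrow> ('a \<Rightarrow> 'b) set" where
  "cinf_hom C B = {f \<in> carrier C \<rightarrow> carrier B.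
     \<forall>m. \<forall>g\<in>Cinf m. \<forall>xs. set xs \<subseteq> carrier C \<and> length xs = m \<longrightarrow>
       f (cinf_op C m g xs) = cinf_op B m g (map f xs)}"

definition cinf_alg :: "'a cinf_ring \<Rightarrow> 'a ring" where
  "cinf_alg C =
     \<lparr>carrier = carrier C,
      monoid.mult = (\<lambda>a b. cinf_op C 2 (\<lambda>x. x 0 * x 1) [a, b]),
      one = cinf_op C 0 (\<lambda>_. 1) [],
      zero = cinf_op C 0 (\<lambda>_. 0) [],
      add = (\<lambda>a b. cinf_op C 2 (\<lambda>x. x 0 + x 1) [a, b])\<rparr>"

definition cinf_const :: "'a cinf_ring \<Rightarrow> real \<Rightarrow> 'a" where
  "cinf_const C c = cinf_op C 0 (\<lambda>_. c) []"

section \<open>Derivations and exterior powers\<close>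

text \<open>Linear maps are extensional, so that uniqueness of a linear map is equality.\<close>

definition linear_maps :: "'r ring \<Rightarrow> ('r, 'm) module \<Rightarrow> ('r, 'n) module \<Rightarrow> ('m \<Rightarrow> 'n) set" where
  "linear_maps R M N = {\<phi> \<in> carrier M \<rightarrow>\<^sub>E carrier N.
     (\<forall>x\<in>carrier M. \<forall>y\<in>carrier M. \<phi> (x \<oplus>\<^bsub>M\<^esub> y) = \<phi> x \<oplus>\<^bsub>N\<^esub> \<phi> y) \<and>
     (\<forall>r\<in>carrier R. \<forall>x\<in>carrier M. \<phi> (r \<odot>\<^bsub>M\<^esub> x) = r \<odot>\<^bsub>N\<^esub> \<phi> x)}"

definition cinf_derivation :: "'a cinf_ring \<Rightarrow> ('a, 'm) module \<Rightarrow> ('a \<Rightarrow> 'm) \<Rightarrow> bool" where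
  "cinf_derivation C M X \<longleftrightarrow>
     X \<in> carrier C \<rightarrow> carrier M \<and>
     (\<forall>n>0. \<forall>h\<in>Cinf n. \<forall>xs. set xs \<subseteq> carrier C \<and> length xs = n \<longrightarrow>
        X (cinf_op C n h xs) = (\<Oplus>\<^bsub>M\<^esub>i\<in>{..<n}. cinf_op C n (pd i h) xs \<odot>\<^bsub>M\<^esub> X (xs ! i)))"

text \<open>
  Here and for exterior powers below, the module and all the test modules have their elements in
  the element type of C.  Up to isomorphism this is no restriction: if C is nonzero, then it
  contains a copy of the reals and is thus infinite, so a module generated by at most as many
  elements as C has is no larger than C; this applies to the module of differentials, to its
  exterior powers and to the submodule generated by the image of a derivation or of a multilinear
  map on them.  If C is zero, then so are all its modules.
\<close>

definition universal_derivation :: "'a cinf_ring \<Rightarrow> ('a, 'a) module \<Rightarrow> ('a \<Rightarrow> 'a) \<Rightarrow> bool" where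
  "universal_derivation C \<Omega> d \<longleftrightarrow>
     module (cinf_alg C) \<Omega> \<and> cinf_derivation C \<Omega> d \<and>
     (\<forall>(N :: ('a, 'a) module) X. module (cinf_alg C) N \<and> cinf_derivation C N X \<longrightarrow>
        (\<exists>!\<phi>. \<phi> \<in> linear_maps (cinf_alg C) \<Omega> N \<and> (\<forall>a\<in>carrier C. X a = \<phi> (d a))))"

definition alternating_multilinear ::
  "'r ring \<Rightarrow> ('r, 'm) module \<Rightarrow> nat \<Rightarrow> ('r, 'n) module \<Rightarrow> ('m list \<Rightarrow> 'n) \<Rightarrow> bool" where
  "alternating_multilinear R M k N u \<longleftrightarrow>
     (\<forall>xs. set xs \<subseteq> carrier M \<and> length xs = k \<longrightarrow>
        u xs \<in> carrier N \<and>
        (\<forall>i<k. \<forall>x\<in>carrier M. \<forall>y\<in>carrier M.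
           u (xs[i := x \<oplus>\<^bsub>M\<^esub> y]) = u (xs[i := x]) \<oplus>\<^bsub>N\<^esub> u (xs[i := y])) \<and>
        (\<forall>i<k. \<forall>r\<in>carrier R. \<forall>x\<in>carrier M.
           u (xs[i := r \<odot>\<^bsub>M\<^esub> x]) = r \<odot>\<^bsub>N\<^esub> u (xs[i := x])) \<and>
        (\<forall>i j. i < j \<and> j < k \<and> xs ! i = xs ! j \<longrightarrow> u xs = \<zero>\<^bsub>N\<^esub>))"

definition exterior_power ::
  "'r ring \<Rightarrow> ('r, 'r) module \<Rightarrow> nat \<Rightarrow> ('r, 'r) module \<Rightarrow> ('r list \<Rightarrow> 'r) \<Rightarrow> bool" where
  "exterior_power R M k P w \<longleftrightarrow>
     module R P \<and> alternating_multilinear R M k P w \<and>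
     (\<forall>(N :: ('r, 'r) module) u. module R N \<and> alternating_multilinear R M k N u \<longrightarrow>
        (\<exists>!\<phi>. \<phi> \<in> linear_maps R P N \<and>
           (\<forall>xs. set xs \<subseteq> carrier M \<and> length xs = k \<longrightarrow> u xs = \<phi> (w xs))))"

section \<open>Commutative differential graded algebras\<close>

record ('a, 'm) cdga_data =
  piece :: "int \<Rightarrow> ('a, 'm) module"
  wedge :: "int \<Rightarrow> int \<Rightarrow> 'm \<Rightarrow> 'm \<Rightarrow> 'm"
  diff :: "int \<Rightarrow> 'm \<Rightarrow> 'm"

definition koszul_sign :: "int \<Rightarrow> ('a, 'm) module \<Rightarrow> 'm \<Rightarrow> 'm" where
  "koszul_sign p M x = (if even p then x else \<ominus>\<^bsub>M\<^esub> x)"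

locale cdga = cinf_ring C for C :: "'a cinf_ring" +
  fixes A :: "('a, 'm) cdga_data"
  assumes piece_module: "\<And>k. module (cinf_alg C) (piece A k)"
    and wedge_closed: "\<And>p q x y. \<lbrakk>x \<in> carrier (piece A p); y \<in> carrier (piece A q)\<rbrakk>
      \<Longrightarrow> wedge A p q x y \<in> carrier (piece A (p + q))"
    and wedge_add_left: "\<And>p q x x' y.
      \<lbrakk>x \<in> carrier (piece A p); x' \<in> carrier (piece A p); y \<in> carrier (piece A q)\<rbrakk>
      \<Longrightarrow> wedge A p q (x \<oplus>\<^bsub>piece A p\<^esub> x') y =
          wedge A p q x y \<oplus>\<^bsub>piece A (p + q)\<^esub> wedge A p q x' y"
    and wedge_add_right: "\<And>p q x y y'.
      \<lbrakk>x \<in> carrier (piece A p); y \<in> carrier (piece A q); y' \<in> carrier (piece A q)\<rbrakk>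
      \<Longrightarrow> wedge A p q x (y \<oplus>\<^bsub>piece A q\<^esub> y') =
          wedge A p q x y \<oplus>\<^bsub>piece A (p + q)\<^esub> wedge A p q x y'"
    and wedge_smult_left: "\<And>p q r x y.
      \<lbrakk>r \<in> carrier C; x \<in> carrier (piece A p); y \<in> carrier (piece A q)\<rbrakk>
      \<Longrightarrow> wedge A p q (r \<odot>\<^bsub>piece A p\<^esub> x) y = r \<odot>\<^bsub>piece A (p + q)\<^esub> wedge A p q x y"
    and wedge_smult_right: "\<And>p q r x y.
      \<lbrakk>r \<in> carrier C; x \<in> carrier (piece A p); y \<in> carrier (piece A q)\<rbrakk>
      \<Longrightarrow> wedge A p q x (r \<odot>\<^bsub>piece A q\<^esub> y) = r \<odot>\<^bsub>piece A (p + q)\<^esub> wedge A p q x y"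
    and wedge_assoc: "\<And>p q s x y z.
      \<lbrakk>x \<in> carrier (piece A p); y \<in> carrier (piece A q); z \<in> carrier (piece A s)\<rbrakk>
      \<Longrightarrow> wedge A (p + q) s (wedge A p q x y) z = wedge A p (q + s) x (wedge A q s y z)"
    and wedge_comm: "\<And>p q x y. \<lbrakk>x \<in> carrier (piece A p); y \<in> carrier (piece A q)\<rbrakk>
      \<Longrightarrow> wedge A p q x y = koszul_sign (p * q) (piece A (p + q)) (wedge A q p y x)"
    and diff_closed: "\<And>p x. x \<in> carrier (piece A p) \<Longrightarrow> diff A p x \<in> carrier (piece A (p + 1))"
    and diff_add: "\<And>p x y. \<lbrakk>x \<in> carrier (piece A p); y \<in> carrier (piece A p)\<rbrakk>
      \<Longrightarrow> diff A p (x \<oplus>\<^bsub>piece A p\<^esub> y) = diff A p x \<oplus>\<^bsub>piece A (p + 1)\<^esub> diff A p y"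
    and diff_scale: "\<And>p c x. x \<in> carrier (piece A p)
      \<Longrightarrow> diff A p (cinf_const C c \<odot>\<^bsub>piece A p\<^esub> x) =
          cinf_const C c \<odot>\<^bsub>piece A (p + 1)\<^esub> diff A p x"
    and diff_wedge: "\<And>p q x y. \<lbrakk>x \<in> carrier (piece A p); y \<in> carrier (piece A q)\<rbrakk>
      \<Longrightarrow> diff A (p + q) (wedge A p q x y) =
          wedge A (p + 1) q (diff A p x) y \<oplus>\<^bsub>piece A (p + q + 1)\<^esub>
          koszul_sign p (piece A (p + q + 1)) (wedge A p (q + 1) x (diff A q y))"
    and diff_diff: "\<And>p x. x \<in> carrier (piece A p)
      \<Longrightarrow> diff A (p + 1) (diff A p x) = \<zero>\<^bsub>piece A (p + 2)\<^esub>"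

text \<open>
  A general CDGA in this sense has no distinguished unit, hence there is no condition on units
  in the following definition.  In particular, the zero maps form a CDGA map over every map of
  smooth rings; for algebras with degree 0 part C, unitality has to be demanded separately, and then
  the component in degree 0 coincides with the map of smooth rings.
\<close>

definition cdga_map ::
  "'a cinf_ring \<Rightarrow> ('a, 'm) cdga_data \<Rightarrow> 'b cinf_ring \<Rightarrow> ('b, 'n) cdga_data \<Rightarrow>
   ('a \<Rightarrow> 'b) \<times> (int \<Rightarrow> 'm \<Rightarrow> 'n) \<Rightarrow> bool" where
  "cdga_map C\<^sub>1 A\<^sub>1 C\<^sub>2 A\<^sub>2 = (\<lambda>(\<phi>, F).
     \<phi> \<in> cinf_hom C\<^sub>1 C\<^sub>2 \<and>
     (\<forall>k. F k \<in> carrier (piece A\<^sub>1 k) \<rightarrow>\<^sub>E carrier (piece A\<^sub>2 k)) \<and>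
     (\<forall>k. \<forall>x\<in>carrier (piece A\<^sub>1 k). \<forall>y\<in>carrier (piece A\<^sub>1 k).
        F k (x \<oplus>\<^bsub>piece A\<^sub>1 k\<^esub> y) = F k x \<oplus>\<^bsub>piece A\<^sub>2 k\<^esub> F k y) \<and>
     (\<forall>k. \<forall>r\<in>carrier C\<^sub>1. \<forall>x\<in>carrier (piece A\<^sub>1 k).
        F k (r \<odot>\<^bsub>piece A\<^sub>1 k\<^esub> x) = \<phi> r \<odot>\<^bsub>piece A\<^sub>2 k\<^esub> F k x) \<and>
     (\<forall>p q. \<forall>x\<in>carrier (piece A\<^sub>1 p). \<forall>y\<in>carrier (piece A\<^sub>1 q).
        F (p + q) (wedge A\<^sub>1 p q x y) = wedge A\<^sub>2 p q (F p x) (F q y)) \<and>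
     (\<forall>k. \<forall>x\<in>carrier (piece A\<^sub>1 k). F (k + 1) (diff A\<^sub>1 k x) = diff A\<^sub>2 k (F k x)))"

text \<open>
  The product of a list of elements of degree 1; the empty product is the unit of C, as an element
  of degree 0 in an algebra with degree 0 part C.
\<close>

fun wedge_list :: "'a cinf_ring \<Rightarrow> ('a, 'a) cdga_data \<Rightarrow> 'a list \<Rightarrow> 'a" where
  "wedge_list C A [] = \<one>\<^bsub>cinf_alg C\<^esub>"
| "wedge_list C A (x # xs) = wedge A 1 (int (length xs)) x (wedge_list C A xs)"

text \<open>
  The exterior algebra of \<open>\<Omega>\<close> with the differential extending d: the k-fold product of elements of
  degree 1 is a universal alternating k-linear map, and products with elements of degree 0 are
  scalar multiples.  In degree 0 the equality with C concerns the module structure only (a module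
  record also has unused fields).
\<close>

locale exterior_cdga = cdga C \<Lambda> for C :: "'a cinf_ring" and \<Lambda> :: "('a, 'a) cdga_data" +
  fixes \<Omega> :: "('a, 'a) module" and d :: "'a \<Rightarrow> 'a"
  assumes carrier_piece_0: "carrier (piece \<Lambda> 0) = carrier C"
    and add_piece_0: "\<And>a b. \<lbrakk>a \<in> carrier C; b \<in> carrier C\<rbrakk>
      \<Longrightarrow> a \<oplus>\<^bsub>piece \<Lambda> 0\<^esub> b = a \<oplus>\<^bsub>cinf_alg C\<^esub> b"
    and smult_piece_0: "\<And>a b. \<lbrakk>a \<in> carrier C; b \<in> carrier C\<rbrakk>
      \<Longrightarrow> a \<odot>\<^bsub>piece \<Lambda> 0\<^esub> b = a \<otimes>\<^bsub>cinf_alg C\<^esub> b"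
    and piece_1: "piece \<Lambda> 1 = \<Omega>"
    and piece_neg: "\<And>k. k < 0 \<Longrightarrow> carrier (piece \<Lambda> k) = {\<zero>\<^bsub>piece \<Lambda> k\<^esub>}"
    and piece_exterior: "\<And>k. exterior_power (cinf_alg C) \<Omega> k (piece \<Lambda> (int k)) (wedge_list C \<Lambda>)"
    and wedge_degree_0: "\<And>a k x. \<lbrakk>a \<in> carrier C; x \<in> carrier (piece \<Lambda> k)\<rbrakk>
      \<Longrightarrow> wedge \<Lambda> 0 k a x = a \<odot>\<^bsub>piece \<Lambda> k\<^esub> x"
    and diff_degree_0: "\<And>a. a \<in> carrier C \<Longrightarrow> diff \<Lambda> 0 a = d a"

end

theory Submission
  imports Defs "HOL-Library.Equipollence"
begin

text \<open>
  Composing \<open>d\<^sub>B\<close> with \<open>f\<close> gives a derivation of \<open>C\<close> into \<open>\<Omega>\<^sub>B\<close>, seen as a module over \<open>C\<close>; it factors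
  through \<open>\<Omega>\<^sub>C\<close>, and wedge products of values of the resulting map are alternating, hence factor
  through the exterior powers.  The set of elements on which these maps commute with the
  differentials is closed under sums and wedge products, and it contains \<open>C\<close> and \<open>d\<^sub>C C\<close>, which
  generate everything; the same generation property gives uniqueness.

  The universal properties are only postulated for test modules on the element type of \<open>C\<close>.  They
  extend to modules on any type, since the image of the map in question spans a submodule that
  is no larger than this type: the type is infinite unless \<open>C\<close> is zero, as \<open>C\<close> contains the reals.
\<close>

section \<open>Modules on a prescribed element type\<close>

lemma infinite_times_self_eqpoll:
  assumes "infinite A"
  shows "A \<times> A \<approx> A"
  using card_of_Times_same_infinite[OF assms] by (simp add: eqpoll_iff_card_of_ordIso)

text \<open>Iterating an injective pairing encodes the lists of one fixed length; recording the
  length as well separates the others, and a pair of a number and an element embeds in a pair of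
  elements.\<close>

lemma lists_lepoll_self:
  assumes "infinite (UNIV :: 'a set)"
  shows "(UNIV :: 'a list set) \<lesssim> (UNIV :: 'a set)"
proof -
  have sq: "(UNIV \<times> UNIV :: ('a \<times> 'a) set) \<lesssim> (UNIV :: 'a set)"
    using infinite_times_self_eqpoll[OF assms] by (rule eqpoll_imp_lepoll)
  then obtain p :: "'a \<times> 'a \<Rightarrow> 'a" where p: "inj p"
    by (auto simp: lepoll_def)
  \<comment> \<open>The start value may be arbitrary: codes are only compared for lists of equal
    length.\<close>
  define e where "e = rec_list (undefined :: 'a) (\<lambda>x _ y. p (x, y))"
  have e: "e (x # xs) = p (x, e xs)" for x xs
    by (simp add: e_def)
  have "xs = ys" if "length xs = length ys" "e xs = e ys" for xs ys
    using that by (induction xs ys rule: list_induct2) (auto simp: e dest: injD[OF p])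
  then have "inj (\<lambda>xs. (length xs, e xs))"
    by (auto intro!: injI)
  then have "(UNIV :: 'a list set) \<lesssim> (UNIV \<times> UNIV :: (nat \<times> 'a) set)"
    by (auto simp: lepoll_def)
  also have "(UNIV \<times> UNIV :: (nat \<times> 'a) set) \<lesssim> (UNIV \<times> UNIV :: ('a \<times> 'a) set)"
    using assms by (intro times_lepoll_mono) (auto simp: infinite_le_lepoll)
  also note sq
  finally show ?thesis .
qed

section \<open>Additive maps and generated submodules\<close>

text \<open>The image of zero is its own double, so it cancels. Only additivity is assumed, so that
  the fact also covers differentials, wedge products and semilinear maps.\<close>

lemma additive_zero:
  assumes "abelian_group M" "abelian_group N" "\<phi> \<in> carrier M \<rightarrow> carrier N"
    and "\<And>x y. \<lbrakk>x \<in> carrier M; y \<in> carrier M\<rbrakk> \<Longrightarrow> \<phi> (x \<oplus>\<^bsub>M\<^esub> y) = \<phi> x \<oplus>\<^bsub>N\<^esub> \<phi> y"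
  shows "\<phi> \<zero>\<^bsub>M\<^esub> = \<zero>\<^bsub>N\<^esub>"
proof -
  interpret M: abelian_group M by fact
  interpret N: abelian_group N by fact
  have "\<phi> \<zero>\<^bsub>M\<^esub> \<oplus>\<^bsub>N\<^esub> \<phi> \<zero>\<^bsub>M\<^esub> = \<phi> \<zero>\<^bsub>M\<^esub>"
    using assms(4)[of "\<zero>\<^bsub>M\<^esub>" "\<zero>\<^bsub>M\<^esub>"] by simp
  then show ?thesis
    using assms(3) by (simp add: Pi_iff)
qed

lemma additive_minus:
  assumes "abelian_group M" "abelian_group N" "\<phi> \<in> carrier M \<rightarrow> carrier N"
    and "\<And>x y. \<lbrakk>x \<in> carrier M; y \<in> carrier M\<rbrakk> \<Longrightarrow> \<phi> (x \<oplus>\<^bsub>M\<^esub> y) = \<phi> x \<oplus>\<^bsub>N\<^esub> \<phi> y"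
    and x: "x \<in> carrier M"
  shows "\<phi> (\<ominus>\<^bsub>M\<^esub> x) = \<ominus>\<^bsub>N\<^esub> \<phi> x"
proof -
  interpret M: abelian_group M by fact
  interpret N: abelian_group N by fact
  have "\<phi> (\<ominus>\<^bsub>M\<^esub> x) \<oplus>\<^bsub>N\<^esub> \<phi> x = \<zero>\<^bsub>N\<^esub>"
    using x assms(4)[of "\<ominus>\<^bsub>M\<^esub> x" x] additive_zero[OF assms(1-4)] by (simp add: M.l_neg)
  then show ?thesis
    using x assms(3) by (intro N.minus_equality[symmetric]) (auto simp: Pi_iff)
qed

lemma additive_finsum:
  assumes "abelian_group M" "abelian_group N" "\<phi> \<in> carrier M \<rightarrow> carrier N"
    and "\<And>x y. \<lbrakk>x \<in> carrier M; y \<in> carrier M\<rbrakk> \<Longrightarrow> \<phi> (x \<oplus>\<^bsub>M\<^esub> y) = \<phi> x \<oplus>\<^bsub>N\<^esub> \<phi> y"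
    and "finite I" "g \<in> I \<rightarrow> carrier M"
  shows "\<phi> (\<Oplus>\<^bsub>M\<^esub>i\<in>I. g i) = (\<Oplus>\<^bsub>N\<^esub>i\<in>I. \<phi> (g i))"
proof -
  interpret M: abelian_group M by fact
  interpret N: abelian_group N by fact
  show ?thesis
    using assms(5,6)
  proof (induction I rule: finite_induct)
    case empty
    show ?case using additive_zero[OF assms(1-4)] by simp
  next
    case (insert i I)
    then have "g i \<in> carrier M" "g \<in> I \<rightarrow> carrier M" by auto
    with insert assms(3,4) show ?case
      by (simp add: Pi_iff)
  qed
qed

text \<open>Every \<open>x\<close> equals \<open>1 x = 0 x = 0\<close>.\<close>

lemma zero_ring_module_carrier:
  assumes "module R N" "\<one>\<^bsub>R\<^esub> = \<zero>\<^bsub>R\<^esub>"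
  shows "carrier N = {\<zero>\<^bsub>N\<^esub>}"
proof -
  interpret module R N by fact
  show ?thesis
    using assms(2) by (metis (no_types, lifting) M.zero_closed is_singletonI' is_singleton_the_elem
        singletonD smult_l_null smult_one empty_iff)
qed

text \<open>Closure under negation comes for free, as scaling by \<open>-1\<close>.\<close>

lemma (in module) submoduleI_linear:
  assumes "H \<subseteq> carrier M" "\<zero>\<^bsub>M\<^esub> \<in> H" "\<And>x y. \<lbrakk>x \<in> H; y \<in> H\<rbrakk> \<Longrightarrow> x \<oplus>\<^bsub>M\<^esub> y \<in> H"
    and "\<And>r x. \<lbrakk>r \<in> carrier R; x \<in> H\<rbrakk> \<Longrightarrow> r \<odot>\<^bsub>M\<^esub> x \<in> H"
  shows "submodule H R M"
proof (rule submoduleI)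
  fix x assume x: "x \<in> H"
  then have "(\<ominus> \<one>) \<odot>\<^bsub>M\<^esub> x = \<ominus>\<^bsub>M\<^esub> x"
    using assms(1) by (subst smult_l_minus) auto
  with assms(4)[of "\<ominus> \<one>" x] x show "\<ominus>\<^bsub>M\<^esub> x \<in> H" by simp
qed (use assms in auto)

text \<open>\<open>H\<close> consists of the finite linear combinations of elements of
  \<open>S\<close>. These are indexed by lists of pairs, and over an infinite type such lists are no
  more numerous than the elements. Over the zero ring the type may be finite, but then
  \<open>N\<close> is a single point and \<open>H\<close> can be all of it.\<close>

lemma small_submodule:
  fixes R :: "'r ring" and N :: "('r, 'n) module"
  assumes "module R N" and "infinite (UNIV :: 'r set) \<or> \<one>\<^bsub>R\<^esub> = \<zero>\<^bsub>R\<^esub>"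
    and "S \<subseteq> carrier N" and "S \<lesssim> (UNIV :: 'r set)"
  obtains H where "submodule H R N" "S \<subseteq> H" "H \<lesssim> (UNIV :: 'r set)"
proof (cases "\<one>\<^bsub>R\<^esub> = \<zero>\<^bsub>R\<^esub>")
  case True
  interpret module R N by fact
  have "carrier N \<lesssim> (UNIV :: 'r set)"
    using zero_ring_module_carrier[OF assms(1) True] singleton_lepoll[of _ undefined UNIV] by simp
  then show thesis
    using that carrier_is_submodule assms(3) by blast
next
  case False
  interpret module R N by fact
  have inf: "infinite (UNIV :: 'r set)"
    using False assms(2) by simp
  \<comment> \<open>A linear combination is stored as a list of coefficients and vectors: appending
    lists gives sums, and multiplying all coefficients gives scalar multiples.\<close>
  define comb where "comb l = foldr (\<lambda>(r, s) y. r \<odot>\<^bsub>N\<^esub> s \<oplus>\<^bsub>N\<^esub> y) l \<zero>\<^bsub>N\<^esub>" for l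
  define L where "L = lists (carrier R \<times> S)"
  have comb: "comb [] = \<zero>\<^bsub>N\<^esub>" "comb ((r, s) # l) = r \<odot>\<^bsub>N\<^esub> s \<oplus>\<^bsub>N\<^esub> comb l" for r s l
    by (simp_all add: comb_def)
  have closed: "comb l \<in> carrier N" if "l \<in> L" for l
    using that assms(3) by (induction l) (auto simp: comb L_def)
  have append: "comb (l @ l') = comb l \<oplus>\<^bsub>N\<^esub> comb l'" if "l \<in> L" "l' \<in> L" for l l'
    using that(1)
  proof (induction l)
    case Nil
    then show ?case using closed that by (simp add: comb)
  next
    case (Cons a l)
    obtain r s where "a = (r, s)" by fastforce
    moreover have "l \<in> L" "r \<in> carrier R" "s \<in> carrier N"
      using Cons.prems assms(3) \<open>a = (r, s)\<close> by (auto simp: L_def)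
    ultimately show ?case
      using Cons.IH closed that by (simp add: comb M.a_assoc)
  qed
  have scale: "comb (map (\<lambda>(q, s). (r \<otimes>\<^bsub>R\<^esub> q, s)) l) = r \<odot>\<^bsub>N\<^esub> comb l"
    if "r \<in> carrier R" "l \<in> L" for r l
    using that(2)
  proof (induction l)
    case Nil
    then show ?case using that by (simp add: comb)
  next
    case (Cons a l)
    obtain q s where "a = (q, s)" by fastforce
    moreover have "l \<in> L" "q \<in> carrier R" "s \<in> carrier N"
      using Cons.prems assms(3) \<open>a = (q, s)\<close> by (auto simp: L_def)
    ultimately show ?case
      using Cons.IH closed that by (simp add: comb smult_r_distr smult_assoc1)
  qed
  have "submodule (comb ` L) R N"
  proof (rule submoduleI_linear)
    show "comb ` L \<subseteq> carrier N"
      using closed by auto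
    show "\<zero>\<^bsub>N\<^esub> \<in> comb ` L"
      using comb(1) by (auto simp: L_def intro!: image_eqI[of _ _ "[]"])
  next
    fix x y assume "x \<in> comb ` L" "y \<in> comb ` L"
    then obtain l l' where l: "x = comb l" "y = comb l'" "l \<in> L" "l' \<in> L" by auto
    moreover from l have "l @ l' \<in> L"
      by (simp add: L_def)
    ultimately show "x \<oplus>\<^bsub>N\<^esub> y \<in> comb ` L"
      using append by (metis imageI)
  next
    fix r x assume r: "r \<in> carrier R" and "x \<in> comb ` L"
    then obtain l where l: "x = comb l" "l \<in> L" by auto
    moreover have "map (\<lambda>(q, s). (r \<otimes>\<^bsub>R\<^esub> q, s)) l \<in> L"
      using l(2) r by (induction l) (auto simp: L_def)
    ultimately show "r \<odot>\<^bsub>N\<^esub> x \<in> comb ` L"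
      using scale[OF r l(2)] by (metis imageI)
  qed
  moreover have "S \<subseteq> comb ` L"
  proof
    fix s assume s: "s \<in> S"
    then have "comb [(\<one>\<^bsub>R\<^esub>, s)] = s"
      using assms(3) by (auto simp: comb)
    then show "s \<in> comb ` L"
      using s by (auto simp: L_def intro!: image_eqI[of _ _ "[(\<one>\<^bsub>R\<^esub>, s)]"])
  qed
  moreover have "comb ` L \<lesssim> (UNIV :: 'r set)"
  proof -
    \<comment> \<open>The coefficients lie in \<open>'r\<close> and \<open>S\<close> embeds in
      \<open>'r\<close>, so pairs, and then lists of pairs, still embed in
      \<open>'r\<close>.\<close>
    have "carrier R \<times> S \<lesssim> (UNIV \<times> UNIV :: ('r \<times> 'r) set)"
      using assms(4) by (intro times_lepoll_mono) (auto intro: subset_imp_lepoll)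
    also have "\<dots> \<approx> (UNIV :: 'r set)"
      using inf by (rule infinite_times_self_eqpoll)
    finally have "L \<lesssim> lists (UNIV :: 'r set)"
      unfolding L_def by (rule lists_lepoll_mono)
    then have "L \<lesssim> (UNIV :: 'r set)"
      using lists_lepoll_self[OF inf] lepoll_trans by auto
    then show ?thesis
      using image_lepoll lepoll_trans by blast
  qed
  ultimately show thesis by (rule that)
qed

lemma linear_mapsD:
  assumes "\<phi> \<in> linear_maps R M N"
  shows "\<phi> \<in> carrier M \<rightarrow> carrier N"
    and "x \<in> carrier M \<Longrightarrow> \<phi> x \<in> carrier N"
    and "\<lbrakk>x \<in> carrier M; y \<in> carrier M\<rbrakk> \<Longrightarrow> \<phi> (x \<oplus>\<^bsub>M\<^esub> y) = \<phi> x \<oplus>\<^bsub>N\<^esub> \<phi> y"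
    and "\<lbrakk>r \<in> carrier R; x \<in> carrier M\<rbrakk> \<Longrightarrow> \<phi> (r \<odot>\<^bsub>M\<^esub> x) = r \<odot>\<^bsub>N\<^esub> \<phi> x"
  using assms by (auto simp: linear_maps_def)

lemma compose_linear_maps:
  assumes "module R M" "\<phi> \<in> linear_maps R M N" "\<psi> \<in> linear_maps R N P"
  shows "compose (carrier M) \<psi> \<phi> \<in> linear_maps R M P"
proof -
  interpret module R M by fact
  show ?thesis
    using linear_mapsD[OF assms(2)] linear_mapsD[OF assms(3)]
    by (auto simp: linear_maps_def compose_def)
qed

text \<open>The module structure of a small submodule containing \<open>S\<close> is transported
  along an injection into \<open>'r\<close>; \<open>\<iota>\<close> undoes this injection. A map
  with values in \<open>S\<close> thereby lifts to a module that is admissible in the postulated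
  universal properties.\<close>

lemma small_copy:
  fixes R :: "'r ring" and N :: "('r, 'n) module"
  assumes "module R N" and "infinite (UNIV :: 'r set) \<or> \<one>\<^bsub>R\<^esub> = \<zero>\<^bsub>R\<^esub>"
    and "S \<subseteq> carrier N" and "S \<lesssim> (UNIV :: 'r set)"
  obtains N' :: "('r, 'r) module" and \<iota> where "module R N'" "\<iota> \<in> linear_maps R N' N"
    "inj_on \<iota> (carrier N')" "S \<subseteq> \<iota> ` carrier N'"
proof -
  obtain H where H: "submodule H R N" "S \<subseteq> H" "H \<lesssim> (UNIV :: 'r set)"
    using small_submodule[OF assms] .
  then obtain j :: "'n \<Rightarrow> 'r" where j: "inj_on j H"
    by (auto simp: lepoll_def)
  interpret H: module R "N\<lparr>carrier := H\<rparr>"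
    using submodule.submodule_is_module[OF H(1) assms(1)] .
  define i where "i = inv_into H j"
  have ij: "i (j x) = x" if "x \<in> H" for x
    using that j by (simp add: i_def)
  \<comment> \<open>All operations decode with \<open>i\<close>, compute in \<open>N\<close>, and
    encode again with \<open>j\<close>.\<close>
  define N' :: "('r, 'r) module" where
    "N' = \<lparr>carrier = j ` H, monoid.mult = undefined, one = undefined, zero = j \<zero>\<^bsub>N\<^esub>,
      add = (\<lambda>x y. j (i x \<oplus>\<^bsub>N\<^esub> i y)), smult = (\<lambda>r x. j (r \<odot>\<^bsub>N\<^esub> i x))\<rparr>"
  have HN: "H \<subseteq> carrier N"
    using module.submoduleE(1)[OF assms(1) H(1)] .
  note cl = H.M.r_zero H.M.l_zero H.M.zero_closed H.M.a_closed H.smult_closed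
  have "module R N'"
  proof (rule moduleI)
    show "cring R" by (rule H.is_cring)
    show "abelian_group N'"
    proof (rule abelian_groupI)
      fix x assume "x \<in> carrier N'"
      then obtain h where h: "h \<in> H" "x = j h" by (auto simp: N'_def)
      then show "\<exists>y\<in>carrier N'. y \<oplus>\<^bsub>N'\<^esub> x = \<zero>\<^bsub>N'\<^esub>"
        using H.M.a_inv_closed[of h] H.M.l_neg[of h]
        by (auto simp: N'_def ij intro!: bexI[of _ "\<ominus>\<^bsub>N\<lparr>carrier := H\<rparr>\<^esub> h"])
    qed (use cl H.M.a_assoc H.M.a_comm in \<open>auto simp: N'_def ij\<close>)
  qed (use cl H.smult_l_distr H.smult_r_distr H.smult_assoc1 H.smult_one in \<open>auto simp: N'_def ij\<close>)
  moreover have "restrict i (carrier N') \<in> linear_maps R N' N"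
    using cl HN by (auto simp: linear_maps_def N'_def ij)
  moreover have "inj_on (restrict i (carrier N')) (carrier N')"
    by (auto intro!: inj_onI simp: N'_def ij)
  moreover have "S \<subseteq> restrict i (carrier N') ` carrier N'"
    using H(2) by (force simp: N'_def ij image_image)
  ultimately show thesis by (rule that)
qed

section \<open>Universal properties for arbitrary modules\<close>

text \<open>Iterated partial derivatives never leave a class \<open>K\<close> that is closed under
  \<open>pd\<close>, so the regularity conditions need checking only for single members of
  \<open>K\<close>.\<close>

lemma CinfI_class:
  assumes "g \<in> K"
    and "\<And>h i. \<lbrakk>h \<in> K; i < m\<rbrakk> \<Longrightarrow> pd i h \<in> K"
    and "\<And>h x y. \<lbrakk>h \<in> K; \<forall>i<m. x i = y i\<rbrakk> \<Longrightarrow> h x = h y"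
    and "\<And>h. h \<in> K \<Longrightarrow> continuous_on UNIV h"
    and "\<And>h i x. \<lbrakk>h \<in> K; i < m\<rbrakk> \<Longrightarrow> (\<lambda>t. h (x(i := t))) differentiable (at (x i))"
  shows "g \<in> Cinf m"
proof -
  have "foldr pd js g \<in> K" if "set js \<subseteq> {..<m}" for js
    using that by (induction js) (use assms(1,2) in auto)
  with assms show ?thesis
    unfolding Cinf_def by blast
qed

text \<open>This family contains the constants, the affine functions, addition and multiplication,
  and it is stable under partial derivatives. The conditions on the coefficients rule out variables
  of index at least \<open>m\<close>.\<close>

lemma biaffine_Cinf:
  fixes a b c e :: real
  assumes "m \<le> 2" "m = 0 \<Longrightarrow> b = 0" "m \<le> 1 \<Longrightarrow> c = 0 \<and> e = 0"
  shows "(\<lambda>x. a + b * x 0 + c * x 1 + e * (x 0 * x 1)) \<in> Cinf m"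
proof -
  define q where "q = (\<lambda>(a, b, c, e). \<lambda>x :: nat \<Rightarrow> real. a + b * x 0 + c * x 1 + e * (x 0 * x 1))"
  define K where "K = q ` {(a, b, c, e). (m = 0 \<longrightarrow> b = 0) \<and> (m \<le> 1 \<longrightarrow> c = 0 \<and> e = 0)}"
  have deriv: "((\<lambda>t. q (a, b, c, e) (x(i := t))) has_real_derivative
      (if i = 0 then b + e * x 1 else if i = 1 then c + e * x 0 else 0)) (at t)"
    for a b c e x i t
    by (auto simp: q_def intro!: derivative_eq_intros)
  \<comment> \<open>The derivatives are \<open>b + e * x 1\<close> and \<open>c + e * x 0\<close>,
    again of the form \<open>q\<close> with shifted coefficients.\<close>
  have pd: "pd i (q (a, b, c, e)) =
      (if i = 0 then q (b, 0, e, 0) else if i = 1 then q (c, e, 0, 0) else q (0, 0, 0, 0))"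
    for a b c e i
    using DERIV_imp_deriv[OF deriv] by (auto simp: pd_def q_def fun_eq_iff)
  have "q (a, b, c, e) \<in> Cinf m"
  proof (rule CinfI_class[where K = K])
    show "q (a, b, c, e) \<in> K"
      using assms by (auto simp: K_def)
  next
    fix h i assume "h \<in> K" "i < m"
    then show "pd i h \<in> K"
      using assms(1) by (auto simp: K_def pd)
  next
    fix h and x y :: "nat \<Rightarrow> real" assume "h \<in> K" "\<forall>i<m. x i = y i"
    then show "h x = h y"
      using assms(1) by (cases "m = 0"; cases "m = 1") (auto simp: K_def q_def)
  next
    fix h assume "h \<in> K"
    then show "continuous_on UNIV h"
      by (auto simp: K_def q_def intro!: continuous_intros continuous_on_product_coordinates)
  next
    fix h i and x :: "nat \<Rightarrow> real" assume "h \<in> K"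
    then obtain a b c e where "h = q (a, b, c, e)"
      by (auto simp: K_def)
    then show "(\<lambda>t. h (x(i := t))) differentiable (at (x i))"
      using deriv unfolding real_differentiable_def by blast
  qed
  then show ?thesis
    by (simp add: q_def)
qed

lemma add_Cinf: "(\<lambda>x. x 0 + x 1) \<in> Cinf 2"
  using biaffine_Cinf[of 2 1 1 0 0] by simp

lemma mult_Cinf: "(\<lambda>x. x 0 * x 1) \<in> Cinf 2"
  using biaffine_Cinf[of 2 0 0 1 0] by simp

lemma const_Cinf: "(\<lambda>_. c) \<in> Cinf 0"
  using biaffine_Cinf[of 0 0 0 0 c] by simp

lemma affine_Cinf: "(\<lambda>x. b * x 0 + a) \<in> Cinf 1"
  using biaffine_Cinf[of 1 b 0 0 a] by (simp add: add.commute)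

text \<open>Since \<open>foldr\<close> applies the last list entry first, the iterated derivatives
  of \<open>pd i g\<close> are those of \<open>g\<close> along lists ending in
  \<open>i\<close>.\<close>

lemma pd_Cinf:
  assumes g: "g \<in> Cinf m" and i: "i < m"
  shows "pd i g \<in> Cinf m"
  unfolding Cinf_def mem_Collect_eq
proof (intro conjI allI impI)
  fix x y :: "nat \<Rightarrow> real" assume "\<forall>j<m. x j = y j"
  then have "g (x(i := t)) = g (y(i := t))" for t
    using g by (auto simp: Cinf_def)
  with \<open>\<forall>j<m. x j = y j\<close> i show "pd i g x = pd i g y"
    by (simp add: pd_def)
next
  fix js assume "set js \<subseteq> {..<m}"
  then have js: "set (js @ [i]) \<subseteq> {..<m}"
    using i by simp
  have "continuous_on UNIV (foldr pd (js @ [i]) g)"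
    using g js unfolding Cinf_def by blast
  then show "continuous_on UNIV (foldr pd js (pd i g))"
    by simp
  fix k and x :: "nat \<Rightarrow> real" assume "k < m"
  then have "(\<lambda>t. foldr pd (js @ [i]) g (x(k := t))) differentiable (at (x k))"
    using g js unfolding Cinf_def by blast
  then show "(\<lambda>t. foldr pd js (pd i g) (x(k := t))) differentiable (at (x k))"
    by simp
qed

lemma carrier_cinf_alg [simp]: "carrier (cinf_alg C) = carrier C"
  by (simp add: cinf_alg_def)

lemma cinf_alg_ops:
  "a \<otimes>\<^bsub>cinf_alg C\<^esub> b = cinf_op C 2 (\<lambda>x. x 0 * x 1) [a, b]"
  "a \<oplus>\<^bsub>cinf_alg C\<^esub> b = cinf_op C 2 (\<lambda>x. x 0 + x 1) [a, b]"
  "\<one>\<^bsub>cinf_alg C\<^esub> = cinf_op C 0 (\<lambda>_. 1) []"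
  "\<zero>\<^bsub>cinf_alg C\<^esub> = cinf_op C 0 (\<lambda>_. 0) []"
  by (simp_all add: cinf_alg_def)

lemma cinf_hom_closed: "f \<in> cinf_hom C B \<Longrightarrow> a \<in> carrier C \<Longrightarrow> f a \<in> carrier B"
  by (auto simp: cinf_hom_def)

lemma cinf_hom_op:
  "\<lbrakk>f \<in> cinf_hom C B; g \<in> Cinf m; set xs \<subseteq> carrier C; length xs = m\<rbrakk>
    \<Longrightarrow> f (cinf_op C m g xs) = cinf_op B m g (map f xs)"
  by (auto simp: cinf_hom_def)

text \<open>Sum, product, zero and one are operations of particular smooth functions, which
  \<open>f\<close> preserves.\<close>

lemma cinf_hom_ring_hom: "f \<in> cinf_hom C B \<Longrightarrow> f \<in> ring_hom (cinf_alg C) (cinf_alg B)"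
  unfolding ring_hom_def mem_Collect_eq cinf_alg_ops
  by (intro conjI ballI) (simp_all add: Pi_iff cinf_hom_closed cinf_hom_op[OF _ add_Cinf]
      cinf_hom_op[OF _ mult_Cinf] cinf_hom_op[OF _ const_Cinf] del: One_nat_def)

text \<open>Either the real constants are pairwise distinct in \<open>C\<close>, or two of them
  coincide; in the second case an affine function carries this coincidence to
  \<open>0 = 1\<close>.\<close>

lemma (in cinf_ring) infinite_or_zero_ring:
  "infinite (UNIV :: 'a set) \<or> \<one>\<^bsub>cinf_alg C\<^esub> = \<zero>\<^bsub>cinf_alg C\<^esub>"
proof (cases "inj (cinf_const C)")
  case True
  then show ?thesis
    using infinite_UNIV_char_0 finite_subset[OF subset_UNIV] by (metis finite_imageD)
next
  case False
  then obtain a b where ab: "a \<noteq> b" "cinf_const C a = cinf_const C b"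
    by (auto simp: inj_def)
  \<comment> \<open>The affine function with value 0 at \<open>a\<close> and 1 at
    \<open>b\<close>.\<close>
  define g where "g = (\<lambda>x :: nat \<Rightarrow> real. 1 / (b - a) * x 0 + - a / (b - a))"
  \<comment> \<open>Constants are operations of arity 0, so this is the composition law with a
    constant function inside \<open>g\<close>.\<close>
  have "cinf_op C 1 g [cinf_const C c] = cinf_const C (g (\<lambda>_. c))" for c
    using op_comp[of g 1 "[\<lambda>_. c]" 0 "[]"] affine_Cinf[of "1 / (b - a)" "- a / (b - a)"]
    by (simp add: cinf_const_def const_Cinf g_def)
  then have "cinf_const C (g (\<lambda>_. a)) = cinf_const C (g (\<lambda>_. b))"
    using ab(2) by metis
  then have "cinf_const C 0 = cinf_const C 1"
    using ab(1) by (simp add: g_def diff_divide_distrib[symmetric])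
  then show ?thesis
    by (simp add: cinf_const_def cinf_alg_ops)
qed

text \<open>The record is rebuilt field by field because the type of scalars changes from
  \<open>'s\<close> to \<open>'r\<close>; the underlying abelian group stays the same. Semilinear
  maps over \<open>f\<close> thus become linear maps.\<close>

definition restrict_scalars :: "('r \<Rightarrow> 's) \<Rightarrow> ('s, 'n) module \<Rightarrow> ('r, 'n) module" where
  "restrict_scalars f N = \<lparr>carrier = carrier N, monoid.mult = monoid.mult N, one = one N,
     zero = zero N, add = add N, smult = (\<lambda>r. smult N (f r))\<rparr>"

lemma restrict_scalars_simps [simp]:
  "carrier (restrict_scalars f N) = carrier N"
  "zero (restrict_scalars f N) = zero N"
  "add (restrict_scalars f N) = add N"
  "smult (restrict_scalars f N) r x = f r \<odot>\<^bsub>N\<^esub> x"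
  by (simp_all add: restrict_scalars_def)

lemma module_restrict_scalars:
  assumes "cring R" "module S N" "f \<in> ring_hom R S"
  shows "module R (restrict_scalars f N)"
proof -
  interpret N: module S N by fact
  show ?thesis
  proof (rule moduleI)
    show "abelian_group (restrict_scalars f N)"
      by (rule abelian_groupI) (auto simp: N.M.a_assoc N.M.a_lcomm N.M.a_comm intro: N.M.l_neg)
  qed (use assms in \<open>auto simp: ring_hom_closed ring_hom_add ring_hom_mult ring_hom_one
        N.smult_l_distr N.smult_r_distr N.smult_assoc1\<close>)
qed

section \<open>Derivations with values in arbitrary modules\<close>

lemma cinf_derivationD:
  assumes "cinf_derivation C M X"
  shows "a \<in> carrier C \<Longrightarrow> X a \<in> carrier M"
    and "\<lbrakk>n > 0; h \<in> Cinf n; set xs \<subseteq> carrier C; length xs = n\<rbrakk> \<Longrightarrow>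
      X (cinf_op C n h xs) = (\<Oplus>\<^bsub>M\<^esub>i\<in>{..<n}. cinf_op C n (pd i h) xs \<odot>\<^bsub>M\<^esub> X (xs ! i))"
  using assms by (auto simp: cinf_derivation_def)

lemma universal_derivationD:
  fixes N :: "('a, 'a) module"
  assumes "universal_derivation C \<Omega> d"
  shows "module (cinf_alg C) \<Omega>" "cinf_derivation C \<Omega> d"
    and "\<lbrakk>module (cinf_alg C) N; cinf_derivation C N X\<rbrakk> \<Longrightarrow>
      \<exists>!\<phi>. \<phi> \<in> linear_maps (cinf_alg C) \<Omega> N \<and> (\<forall>a\<in>carrier C. X a = \<phi> (d a))"
proof -
  note u = assms[unfolded universal_derivation_def]
  show "module (cinf_alg C) \<Omega>" "cinf_derivation C \<Omega> d"
    using u[THEN conjunct1] u[THEN conjunct2, THEN conjunct1] .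
  show "\<exists>!\<phi>. \<phi> \<in> linear_maps (cinf_alg C) \<Omega> N \<and> (\<forall>a\<in>carrier C. X a = \<phi> (d a))"
    if "module (cinf_alg C) N" "cinf_derivation C N X"
    by (rule u[THEN conjunct2, THEN conjunct2, THEN spec, THEN spec, THEN mp]) (use that in simp)
qed

text \<open>The arguments in the chain rule all lie in \<open>carrier C\<close>, so values elsewhere
  do not matter. This permits rewriting a derivation as an inclusion composed with a lift.\<close>

lemma (in cinf_ring) cinf_derivation_cong:
  assumes "module (cinf_alg C) N" and X: "cinf_derivation C N X"
    and eq: "\<And>a. a \<in> carrier C \<Longrightarrow> Y a = X a"
  shows "cinf_derivation C N Y"
  unfolding cinf_derivation_def
proof (intro conjI allI impI ballI)
  interpret N: module "cinf_alg C" N by fact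
  show "Y \<in> carrier C \<rightarrow> carrier N"
    using cinf_derivationD(1)[OF X] eq by simp
  fix n :: nat and h xs assume n: "0 < n" and h: "h \<in> Cinf n" and "set xs \<subseteq> carrier C \<and> length xs = n"
  then have xs: "set xs \<subseteq> carrier C" "length xs = n" by auto
  have nth: "xs ! i \<in> carrier C" if "i < n" for i
    using nth_mem[of i xs] that xs by blast
  have "Y (cinf_op C n h xs) = (\<Oplus>\<^bsub>N\<^esub>i\<in>{..<n}. cinf_op C n (pd i h) xs \<odot>\<^bsub>N\<^esub> X (xs ! i))"
    using eq op_closed[OF h xs] cinf_derivationD(2)[OF X n h xs] by simp
  also have "\<dots> = (\<Oplus>\<^bsub>N\<^esub>i\<in>{..<n}. cinf_op C n (pd i h) xs \<odot>\<^bsub>N\<^esub> Y (xs ! i))"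
    using xs h cinf_derivationD(1)[OF X] nth eq by (intro N.M.finsum_cong')
      (auto intro!: N.smult_closed op_closed pd_Cinf)
  finally show "Y (cinf_op C n h xs) =
      (\<Oplus>\<^bsub>N\<^esub>i\<in>{..<n}. cinf_op C n (pd i h) xs \<odot>\<^bsub>N\<^esub> Y (xs ! i))" .
qed

text \<open>Both sides of the chain rule for \<open>X\<close> have the same image under the
  injective linear map \<open>\<phi>\<close>. This lifts derivations to small copies and to
  submodules.\<close>

lemma (in cinf_ring) cinf_derivation_cancel_inj:
  assumes "module (cinf_alg C) M" "module (cinf_alg C) N" "\<phi> \<in> linear_maps (cinf_alg C) M N"
    and "inj_on \<phi> (carrier M)" "cinf_derivation C N (\<lambda>a. \<phi> (X a))"
    and X: "X \<in> carrier C \<rightarrow> carrier M"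
  shows "cinf_derivation C M X"
  unfolding cinf_derivation_def
proof (intro conjI X allI impI ballI)
  interpret M: module "cinf_alg C" M by fact
  interpret N: module "cinf_alg C" N by fact
  fix n :: nat and h xs assume n: "0 < n" and h: "h \<in> Cinf n" and "set xs \<subseteq> carrier C \<and> length xs = n"
  then have xs: "set xs \<subseteq> carrier C" "length xs = n" by auto
  have cl: "X (xs ! i) \<in> carrier M" "cinf_op C n (pd i h) xs \<in> carrier C" if "i < n" for i
    using nth_mem[of i xs] that xs X h by (blast intro: op_closed pd_Cinf)+
  have "\<phi> (\<Oplus>\<^bsub>M\<^esub>i\<in>{..<n}. cinf_op C n (pd i h) xs \<odot>\<^bsub>M\<^esub> X (xs ! i)) =
      (\<Oplus>\<^bsub>N\<^esub>i\<in>{..<n}. \<phi> (cinf_op C n (pd i h) xs \<odot>\<^bsub>M\<^esub> X (xs ! i)))"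
    using cl linear_mapsD[OF assms(3)]
    by (intro additive_finsum M.abelian_group_axioms N.abelian_group_axioms) auto
  also have "\<dots> = (\<Oplus>\<^bsub>N\<^esub>i\<in>{..<n}. cinf_op C n (pd i h) xs \<odot>\<^bsub>N\<^esub> \<phi> (X (xs ! i)))"
    using cl linear_mapsD[OF assms(3)] by (intro N.M.finsum_cong') auto
  also have "\<dots> = \<phi> (X (cinf_op C n h xs))"
    using cinf_derivationD(2)[OF assms(5) n h xs] by simp
  finally show "X (cinf_op C n h xs) = (\<Oplus>\<^bsub>M\<^esub>i\<in>{..<n}. cinf_op C n (pd i h) xs \<odot>\<^bsub>M\<^esub> X (xs ! i))"
    using X cl op_closed[OF h xs] by (intro inj_onD[OF assms(4)]) (auto intro!: M.M.finsum_closed)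
qed

text \<open>The image of \<open>X\<close> is no larger than \<open>'a\<close>, so \<open>X\<close>
  lifts to a small copy \<open>N'\<close>. The postulated universal property applies there, and
  composing with \<open>\<iota>\<close> returns to \<open>N\<close>. Only existence is needed here;
  uniqueness will follow from generation by exact elements.\<close>

lemma (in cinf_ring) universal_derivation_factor:
  assumes "universal_derivation C \<Omega> d"
    and N: "module (cinf_alg C) N" and X: "cinf_derivation C N X"
  obtains \<phi> where "\<phi> \<in> linear_maps (cinf_alg C) \<Omega> N" "\<And>a. a \<in> carrier C \<Longrightarrow> \<phi> (d a) = X a"
proof -
  have \<Omega>: "module (cinf_alg C) \<Omega>" "cinf_derivation C \<Omega> d"
    using universal_derivationD(1,2)[OF assms(1)] .
  have img: "X ` carrier C \<subseteq> carrier N" "X ` carrier C \<lesssim> (UNIV :: 'a set)"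
    using cinf_derivationD(1)[OF X] by (auto simp: lepoll_iff)
  obtain N' :: "('a, 'a) module" and \<iota> where N': "module (cinf_alg C) N'"
    "\<iota> \<in> linear_maps (cinf_alg C) N' N" "inj_on \<iota> (carrier N')" "X ` carrier C \<subseteq> \<iota> ` carrier N'"
    using small_copy[OF N infinite_or_zero_ring img] .
  define Y where "Y a = inv_into (carrier N') \<iota> (X a)" for a
  have Y: "Y a \<in> carrier N' \<and> \<iota> (Y a) = X a" if "a \<in> carrier C" for a
    using subsetD[OF N'(4) imageI[OF that]] by (simp add: Y_def inv_into_into f_inv_into_f)
  have "cinf_derivation C N (\<lambda>a. \<iota> (Y a))"
    using Y by (intro cinf_derivation_cong[OF N X]) blast
  then have Y': "cinf_derivation C N' Y"
    using N' N Y by (intro cinf_derivation_cancel_inj[of N' N \<iota>]) auto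
  obtain \<phi> where \<phi>: "\<phi> \<in> linear_maps (cinf_alg C) \<Omega> N'" "\<forall>a\<in>carrier C. Y a = \<phi> (d a)"
    using universal_derivationD(3)[OF assms(1) N'(1) Y', THEN ex1_implies_ex] by blast
  show thesis
  proof (rule that)
    show "compose (carrier \<Omega>) \<iota> \<phi> \<in> linear_maps (cinf_alg C) \<Omega> N"
      using compose_linear_maps[OF \<Omega>(1) \<phi>(1) N'(2)] .
    show "compose (carrier \<Omega>) \<iota> \<phi> (d a) = X a" if "a \<in> carrier C" for a
      using that Y \<phi>(2) cinf_derivationD(1)[OF \<Omega>(2)] by (simp add: compose_def)
  qed
qed

lemma submodule_inclusion:
  assumes "module R M" "submodule H R M"
  shows "module R (M\<lparr>carrier := H\<rparr>)" "restrict id H \<in> linear_maps R (M\<lparr>carrier := H\<rparr>) M" "H \<subseteq> carrier M"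
proof -
  show H: "module R (M\<lparr>carrier := H\<rparr>)"
    using assms by (simp add: submodule.submodule_is_module)
  show "H \<subseteq> carrier M"
    using assms by (simp add: module.submoduleE(1))
  then show "restrict id H \<in> linear_maps R (M\<lparr>carrier := H\<rparr>) M"
    using module.submoduleE[OF assms] by (auto simp: linear_maps_def)
qed

lemma id_linear_maps:
  assumes "module R M"
  shows "restrict id (carrier M) \<in> linear_maps R M M"
proof -
  interpret module R M by fact
  show ?thesis by (auto simp: linear_maps_def)
qed

text \<open>Universality retracts \<open>\<Omega>\<close> onto any submodule containing the exact elements.\<close>

lemma (in cinf_ring) universal_derivation_generated:
  assumes "universal_derivation C \<Omega> d"
    and H: "submodule H (cinf_alg C) \<Omega>" and "d ` carrier C \<subseteq> H"
  shows "H = carrier \<Omega>"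
proof -
  have \<Omega>: "module (cinf_alg C) \<Omega>" and d: "cinf_derivation C \<Omega> d"
    using universal_derivationD(1,2)[OF assms(1)] .
  note incl = submodule_inclusion[OF \<Omega> H]
  \<comment> \<open>As the inclusion of \<open>H\<close> is injective, \<open>d\<close> is also a
    derivation into \<open>H\<close>, which makes \<open>H\<close> itself a test module.\<close>
  have "cinf_derivation C \<Omega> (\<lambda>a. restrict id H (d a))"
    by (rule cinf_derivation_cong[OF \<Omega> d]) (use assms(3) in \<open>simp add: image_subset_iff\<close>)
  then have dH: "cinf_derivation C (\<Omega>\<lparr>carrier := H\<rparr>) d"
    using assms(3) by (intro cinf_derivation_cancel_inj[where X = d, OF incl(1) \<Omega> incl(2)])
      (auto intro: inj_onI)
  obtain \<pi> where \<pi>: "\<pi> \<in> linear_maps (cinf_alg C) \<Omega> (\<Omega>\<lparr>carrier := H\<rparr>)"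
    "\<forall>a\<in>carrier C. d a = \<pi> (d a)"
    using universal_derivationD(3)[OF assms(1) incl(1) dH, THEN ex1_implies_ex] by blast
  \<comment> \<open>Both maps are linear from \<open>\<Omega>\<close> to itself and fix the exact
    elements, so both are the unique factorization of \<open>d\<close> through itself.\<close>
  have "compose (carrier \<Omega>) (restrict id H) \<pi> = restrict id (carrier \<Omega>)"
  proof -
    have "\<exists>!\<phi>. \<phi> \<in> linear_maps (cinf_alg C) \<Omega> \<Omega> \<and> (\<forall>a\<in>carrier C. d a = \<phi> (d a))"
      using universal_derivationD(3)[OF assms(1) \<Omega> d] .
    moreover have "\<forall>a\<in>carrier C. d a = compose (carrier \<Omega>) (restrict id H) \<pi> (d a)"
      using \<pi>(2) assms(3) cinf_derivationD(1)[OF d] by (auto simp: compose_def)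
    moreover have "\<forall>a\<in>carrier C. d a = restrict id (carrier \<Omega>) (d a)"
      using cinf_derivationD(1)[OF d] by auto
    ultimately show ?thesis
      using compose_linear_maps[OF \<Omega> \<pi>(1) incl(2)] id_linear_maps[OF \<Omega>] by blast
  qed
  then have eq: "compose (carrier \<Omega>) (restrict id H) \<pi> x = restrict id (carrier \<Omega>) x" for x
    by (rule fun_cong)
  have "x \<in> H" if x: "x \<in> carrier \<Omega>" for x
  proof -
    have "\<pi> x \<in> H"
      using linear_mapsD(2)[OF \<pi>(1) x] by simp
    with eq[of x] x show ?thesis
      by (simp add: compose_eq)
  qed
  with incl(3) show ?thesis by blast
qed

section \<open>Exterior powers and multilinear maps into arbitrary modules\<close>

lemma exterior_powerD:
  fixes N :: "('r, 'r) module"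
  assumes "exterior_power R M k P w"
  shows "module R P" "alternating_multilinear R M k P w"
    and "\<lbrakk>set xs \<subseteq> carrier M; length xs = k\<rbrakk> \<Longrightarrow> w xs \<in> carrier P"
    and "\<lbrakk>module R N; alternating_multilinear R M k N u\<rbrakk> \<Longrightarrow> \<exists>!\<phi>. \<phi> \<in> linear_maps R P N \<and>
      (\<forall>xs. set xs \<subseteq> carrier M \<and> length xs = k \<longrightarrow> u xs = \<phi> (w xs))"
proof -
  note u = assms[unfolded exterior_power_def]
  show "module R P" and w: "alternating_multilinear R M k P w"
    using u[THEN conjunct1] u[THEN conjunct2, THEN conjunct1] .
  show "w xs \<in> carrier P" if "set xs \<subseteq> carrier M" "length xs = k"
    using w that by (simp add: alternating_multilinear_def)
  show "\<exists>!\<phi>. \<phi> \<in> linear_maps R P N \<and>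
      (\<forall>xs. set xs \<subseteq> carrier M \<and> length xs = k \<longrightarrow> u xs = \<phi> (w xs))"
    if "module R N" "alternating_multilinear R M k N u"
    by (rule u[THEN conjunct2, THEN conjunct2, THEN spec, THEN spec, THEN mp]) (use that in simp)
qed

text \<open>Each identity required of the lift \<open>v\<close> holds after applying the injective
  map \<open>\<iota>\<close>, because it holds for \<open>u\<close>.\<close>

lemma alternating_multilinear_cancel_inj:
  assumes "module R N" "module R N'" "\<iota> \<in> linear_maps R N' N" "inj_on \<iota> (carrier N')"
    and "module R M" "alternating_multilinear R M k N u"
    and v: "\<And>xs. \<lbrakk>set xs \<subseteq> carrier M; length xs = k\<rbrakk> \<Longrightarrow> v xs \<in> carrier N' \<and> \<iota> (v xs) = u xs"
  shows "alternating_multilinear R M k N' v"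
  unfolding alternating_multilinear_def
proof (intro allI impI conjI ballI)
  interpret N: module R N by fact
  interpret N': module R N' by fact
  interpret M: module R M by fact
  note \<iota> = linear_mapsD[OF assms(3)]
  note u = assms(6)[unfolded alternating_multilinear_def, rule_format]
  fix xs assume "set xs \<subseteq> carrier M \<and> length xs = k"
  then have xs: "set xs \<subseteq> carrier M" "length xs = k" by auto
  show "v xs \<in> carrier N'" using v xs by blast
  have upd: "set (xs[i := x]) \<subseteq> carrier M" "length (xs[i := x]) = k"
    if "x \<in> carrier M" for i x
    using xs that set_update_subset_insert by fastforce+
  { fix i x y assume "i < k" "x \<in> carrier M" "y \<in> carrier M"
    then show "v (xs[i := x \<oplus>\<^bsub>M\<^esub> y]) = v (xs[i := x]) \<oplus>\<^bsub>N'\<^esub> v (xs[i := y])"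
      using v upd xs \<iota>(3) u[of xs] by (intro inj_onD[OF assms(4)]) auto }
  { fix i r x assume "i < k" "r \<in> carrier R" "x \<in> carrier M"
    then show "v (xs[i := r \<odot>\<^bsub>M\<^esub> x]) = r \<odot>\<^bsub>N'\<^esub> v (xs[i := x])"
      using v upd xs \<iota>(4) u[of xs] by (intro inj_onD[OF assms(4)]) auto }
  have "\<iota> \<zero>\<^bsub>N'\<^esub> = \<zero>\<^bsub>N\<^esub>"
    using \<iota> N.abelian_group_axioms N'.abelian_group_axioms by (intro additive_zero) auto
  moreover fix i j assume "i < j \<and> j < k \<and> xs ! i = xs ! j"
  ultimately show "v xs = \<zero>\<^bsub>N'\<^esub>"
    using v upd xs u[of xs] by (intro inj_onD[OF assms(4)]) auto
qed

text \<open>The values of \<open>u\<close> are indexed by lists over \<open>'r\<close>, so they fit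
  into a small copy of a submodule of \<open>N\<close>; the lift of \<open>u\<close> to this copy
  factors by the postulated universal property.\<close>

lemma exterior_power_factor:
  fixes R :: "'r ring" and N :: "('r, 'n) module"
  assumes ext: "exterior_power R M k P w" and M: "module R M"
    and small: "infinite (UNIV :: 'r set) \<or> \<one>\<^bsub>R\<^esub> = \<zero>\<^bsub>R\<^esub>"
    and N: "module R N" and u: "alternating_multilinear R M k N u"
  obtains \<phi> where "\<phi> \<in> linear_maps R P N"
    "\<And>xs. \<lbrakk>set xs \<subseteq> carrier M; length xs = k\<rbrakk> \<Longrightarrow> \<phi> (w xs) = u xs"
proof -
  define T where "T = {xs. set xs \<subseteq> carrier M \<and> length xs = k}"
  have uT: "u ` T \<subseteq> carrier N"
    using u by (auto simp: T_def alternating_multilinear_def)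
  \<comment> \<open>Over the zero ring, where lists over \<open>'r\<close> may outnumber its
    elements, all values of \<open>u\<close> are zero.\<close>
  have uT_small: "u ` T \<lesssim> (UNIV :: 'r set)"
  proof (cases "\<one>\<^bsub>R\<^esub> = \<zero>\<^bsub>R\<^esub>")
    case True
    then have "u ` T \<subseteq> {\<zero>\<^bsub>N\<^esub>}"
      using zero_ring_module_carrier[OF N] uT by simp
    then show ?thesis
      by (auto simp: lepoll_iff)
  next
    case False
    have "u ` T \<lesssim> T"
      by (rule image_lepoll)
    also have "T \<lesssim> (UNIV :: 'r list set)"
      by (simp add: subset_imp_lepoll)
    also have "\<dots> \<lesssim> (UNIV :: 'r set)"
      using False small lists_lepoll_self by auto
    finally show ?thesis .
  qed
  obtain N' :: "('r, 'r) module" and \<iota> where N': "module R N'"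
    "\<iota> \<in> linear_maps R N' N" "inj_on \<iota> (carrier N')" "u ` T \<subseteq> \<iota> ` carrier N'"
    using small_copy[OF N small uT uT_small] .
  define v where "v xs = inv_into (carrier N') \<iota> (u xs)" for xs
  have v: "v xs \<in> carrier N' \<and> \<iota> (v xs) = u xs" if "xs \<in> T" for xs
    using subsetD[OF N'(4) imageI[OF that]] by (simp add: v_def inv_into_into f_inv_into_f)
  have v_alt: "alternating_multilinear R M k N' v"
    by (intro alternating_multilinear_cancel_inj[OF N N'(1-3) M u]) (simp add: v T_def)
  then obtain \<phi> where \<phi>: "\<phi> \<in> linear_maps R P N'" "\<forall>xs\<in>T. v xs = \<phi> (w xs)"
    using exterior_powerD(4)[OF ext N'(1) v_alt, THEN ex1_implies_ex] unfolding T_def by blast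
  show thesis
  proof (rule that)
    show "compose (carrier P) \<iota> \<phi> \<in> linear_maps R P N"
      using compose_linear_maps[OF exterior_powerD(1)[OF ext] \<phi>(1) N'(2)] .
    fix xs assume xs: "set xs \<subseteq> carrier M" "length xs = k"
    show "compose (carrier P) \<iota> \<phi> (w xs) = u xs"
      using exterior_powerD(3)[OF ext xs] xs v \<phi>(2) by (auto simp: compose_def T_def)
  qed
qed

text \<open>The same retraction argument as for the module of differentials: \<open>w\<close> is
  also alternating into \<open>H\<close>, and the resulting map to \<open>H\<close>, followed by
  inclusion, must be the identity of \<open>P\<close>.\<close>

lemma exterior_power_generated:
  assumes ext: "exterior_power R M k P w" and M: "module R M" and H: "submodule H R P"
    and w: "\<And>xs. \<lbrakk>set xs \<subseteq> carrier M; length xs = k\<rbrakk> \<Longrightarrow> w xs \<in> H"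
  shows "H = carrier P"
proof -
  note P = exterior_powerD[OF ext]
  note incl = submodule_inclusion[OF P(1) H]
  have w_alt: "alternating_multilinear R M k (P\<lparr>carrier := H\<rparr>) w"
    by (rule alternating_multilinear_cancel_inj[OF P(1) incl(1,2) _ M P(2)])
      (use w in \<open>auto intro: inj_onI\<close>)
  obtain \<pi> where \<pi>: "\<pi> \<in> linear_maps R P (P\<lparr>carrier := H\<rparr>)"
    "\<forall>xs. set xs \<subseteq> carrier M \<and> length xs = k \<longrightarrow> w xs = \<pi> (w xs)"
    using exterior_powerD(4)[OF ext incl(1) w_alt, THEN ex1_implies_ex] by blast
  have "compose (carrier P) (restrict id H) \<pi> = restrict id (carrier P)"
  proof -
    have "\<exists>!\<phi>. \<phi> \<in> linear_maps R P P \<and>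
        (\<forall>xs. set xs \<subseteq> carrier M \<and> length xs = k \<longrightarrow> w xs = \<phi> (w xs))"
      using exterior_powerD(4)[OF ext P(1,2)] .
    moreover have "\<forall>xs. set xs \<subseteq> carrier M \<and> length xs = k \<longrightarrow>
        w xs = compose (carrier P) (restrict id H) \<pi> (w xs)"
      using \<pi>(2) w P(3) by (auto simp: compose_def)
    moreover have "\<forall>xs. set xs \<subseteq> carrier M \<and> length xs = k \<longrightarrow> w xs = restrict id (carrier P) (w xs)"
      using P(3) by auto
    ultimately show ?thesis
      using compose_linear_maps[OF P(1) \<pi>(1) incl(2)] id_linear_maps[OF P(1)] by blast
  qed
  then have eq: "compose (carrier P) (restrict id H) \<pi> x = restrict id (carrier P) x" for x
    by (rule fun_cong)
  have "x \<in> H" if x: "x \<in> carrier P" for x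
  proof -
    have "\<pi> x \<in> H"
      using linear_mapsD(2)[OF \<pi>(1) x] by simp
    with eq[of x] x show ?thesis
      by (simp add: compose_eq)
  qed
  with incl(3) show ?thesis by blast
qed

section \<open>Maps of exterior algebras\<close>

text \<open>Combined with generation, this reduces equality of linear maps to generators. The
  restrictions in the hypotheses allow \<open>\<alpha>\<close> and \<open>\<beta>\<close> to be
  plain lambda terms, although linear maps are extensional.\<close>

lemma equalizer_submodule:
  assumes "module R M" "module R N"
    and \<alpha>: "restrict \<alpha> (carrier M) \<in> linear_maps R M N"
    and \<beta>: "restrict \<beta> (carrier M) \<in> linear_maps R M N"
  shows "submodule {x \<in> carrier M. \<alpha> x = \<beta> x} R M"
proof -
  interpret M: module R M by fact
  interpret N: module R N by fact
  have zero: "\<gamma> \<zero>\<^bsub>M\<^esub> = \<zero>\<^bsub>N\<^esub>" if "restrict \<gamma> (carrier M) \<in> linear_maps R M N" for \<gamma>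
    using additive_zero[OF M.abelian_group_axioms N.abelian_group_axioms linear_mapsD(1,3)[OF that]]
    by simp
  show ?thesis
    using zero[OF \<alpha>] zero[OF \<beta>] linear_mapsD(3,4)[OF \<alpha>] linear_mapsD(3,4)[OF \<beta>]
    by (intro M.submoduleI_linear) auto
qed

section \<open>Zero elements under products and differentials\<close>

context cdga
begin

lemma piece_abelian_group: "abelian_group (piece A k)"
  using piece_module by (rule module.axioms)

lemma wedge_zero_left: "y \<in> carrier (piece A q) \<Longrightarrow> wedge A p q \<zero>\<^bsub>piece A p\<^esub> y = \<zero>\<^bsub>piece A (p + q)\<^esub>"
  by (rule additive_zero[OF piece_abelian_group piece_abelian_group, where \<phi> = "\<lambda>x. wedge A p q x y"])
    (auto simp: wedge_closed wedge_add_left)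

lemma wedge_zero_right: "x \<in> carrier (piece A p) \<Longrightarrow> wedge A p q x \<zero>\<^bsub>piece A q\<^esub> = \<zero>\<^bsub>piece A (p + q)\<^esub>"
  by (rule additive_zero[OF piece_abelian_group piece_abelian_group]) (auto simp: wedge_closed wedge_add_right)

lemma diff_zero: "diff A p \<zero>\<^bsub>piece A p\<^esub> = \<zero>\<^bsub>piece A (p + 1)\<^esub>"
  by (rule additive_zero[OF piece_abelian_group piece_abelian_group]) (auto simp: diff_closed diff_add)

end

section \<open>Products of elements of degree 1 as generators\<close>

context exterior_cdga
begin

lemma one_closed: "\<one>\<^bsub>cinf_alg C\<^esub> \<in> carrier C"
  using op_closed[OF const_Cinf[of 1], of "[]"] by (simp add: cinf_alg_ops)

lemma \<Omega>_module: "module (cinf_alg C) \<Omega>"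
  using piece_module[of 1] piece_1 by simp

lemma wedge_list_closed:
  "set xs \<subseteq> carrier \<Omega> \<Longrightarrow> wedge_list C \<Lambda> xs \<in> carrier (piece \<Lambda> (int (length xs)))"
  using exterior_powerD(3)[OF piece_exterior] by blast

lemma wedge_one_left: "x \<in> carrier (piece \<Lambda> k) \<Longrightarrow> wedge \<Lambda> 0 k \<one>\<^bsub>cinf_alg C\<^esub> x = x"
  using wedge_degree_0[OF one_closed] module.smult_one[OF piece_module] by simp

text \<open>By definition the left side is \<open>x\<close> times the unit. Graded commutativity
  moves the unit to the left with sign \<open>+\<close>, as its degree is 0, and there it acts as a
  scalar.\<close>

lemma wedge_list_singleton:
  assumes "x \<in> carrier \<Omega>"
  shows "wedge_list C \<Lambda> [x] = x"
proof -
  have x: "x \<in> carrier (piece \<Lambda> 1)" and one: "\<one>\<^bsub>cinf_alg C\<^esub> \<in> carrier (piece \<Lambda> 0)"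
    using assms one_closed by (simp_all add: piece_1 carrier_piece_0)
  show ?thesis
    using wedge_comm[OF x one] wedge_one_left[OF x] by (simp add: koszul_sign_def)
qed

lemma wedge_list_append:
  assumes "set xs \<subseteq> carrier \<Omega>" "set ys \<subseteq> carrier \<Omega>"
  shows "wedge \<Lambda> (int (length xs)) (int (length ys)) (wedge_list C \<Lambda> xs) (wedge_list C \<Lambda> ys) =
    wedge_list C \<Lambda> (xs @ ys)"
  using assms(1)
proof (induction xs)
  case Nil
  then show ?case
    using wedge_one_left[OF wedge_list_closed[OF assms(2)]] by simp
next
  case (Cons x xs)
  then have "x \<in> carrier (piece \<Lambda> 1)"
    by (simp add: piece_1)
  with Cons assms(2) show ?case
    using wedge_assoc[of x 1 "wedge_list C \<Lambda> xs" "int (length xs)" "wedge_list C \<Lambda> ys" "int (length ys)"]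
    by (simp add: wedge_list_closed)
qed

lemma wedge_list_generated:
  assumes "submodule H (cinf_alg C) (piece \<Lambda> (int k))"
    and "\<And>xs. \<lbrakk>set xs \<subseteq> carrier \<Omega>; length xs = k\<rbrakk> \<Longrightarrow> wedge_list C \<Lambda> xs \<in> H"
  shows "H = carrier (piece \<Lambda> (int k))"
  using exterior_power_generated[OF piece_exterior \<Omega>_module assms] .

text \<open>The equalizer of \<open>\<alpha>\<close> and \<open>\<beta>\<close> is a submodule
  containing all k-fold products, hence everything.\<close>

lemma wedge_list_eqI:
  assumes "module (cinf_alg C) N"
    and "restrict \<alpha> (carrier (piece \<Lambda> (int k))) \<in> linear_maps (cinf_alg C) (piece \<Lambda> (int k)) N"
    and "restrict \<beta> (carrier (piece \<Lambda> (int k))) \<in> linear_maps (cinf_alg C) (piece \<Lambda> (int k)) N"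
    and "\<And>xs. \<lbrakk>set xs \<subseteq> carrier \<Omega>; length xs = k\<rbrakk> \<Longrightarrow> \<alpha> (wedge_list C \<Lambda> xs) = \<beta> (wedge_list C \<Lambda> xs)"
    and "x \<in> carrier (piece \<Lambda> (int k))"
  shows "\<alpha> x = \<beta> x"
proof -
  have "{x \<in> carrier (piece \<Lambda> (int k)). \<alpha> x = \<beta> x} = carrier (piece \<Lambda> (int k))"
    using assms(4) wedge_list_closed
    by (intro wedge_list_generated equalizer_submodule[OF piece_module assms(1-3)]) blast
  then show ?thesis
    using assms(5) by blast
qed

end

lemma restrict_linear_map: "g \<in> linear_maps R M N \<Longrightarrow> restrict g (carrier M) = g"
  by (auto simp: linear_maps_def PiE_def extensional_restrict)

section \<open>Construction of the graded map over \<open>f\<close>\<close>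

locale exterior_cdga_hom =
  dom: exterior_cdga C \<Lambda> \<Omega> d + cod: exterior_cdga B \<Lambda>' \<Omega>' d'
  for C :: "'a cinf_ring" and \<Lambda> \<Omega> d and B :: "'b cinf_ring" and \<Lambda>' \<Omega>' d' +
  fixes f :: "'a \<Rightarrow> 'b"
  assumes dom_universal: "universal_derivation C \<Omega> d"
    and cod_universal: "universal_derivation B \<Omega>' d'"
    and hom: "f \<in> cinf_hom C B"
begin

lemma module_restrict:
  assumes "module (cinf_alg B) N"
  shows "module (cinf_alg C) (restrict_scalars f N)"
proof -
  \<comment> \<open>The module axioms of \<open>\<Omega>\<close> include that
    \<open>cinf_alg C\<close> is a commutative ring.\<close>
  interpret module "cinf_alg C" \<Omega> by (rule dom.\<Omega>_module)
  show ?thesis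
    using module_restrict_scalars[OF is_cring assms cinf_hom_ring_hom[OF hom]] .
qed

lemma d_closed: "a \<in> carrier C \<Longrightarrow> d a \<in> carrier \<Omega>"
  using cinf_derivationD(1)[OF universal_derivationD(2)[OF dom_universal]] .

lemma d'_closed: "b \<in> carrier B \<Longrightarrow> d' b \<in> carrier \<Omega>'"
  using cinf_derivationD(1)[OF universal_derivationD(2)[OF cod_universal]] .

text \<open>Since \<open>f\<close> preserves operations, the coefficients in the chain rule for
  \<open>d'\<close> at the images under \<open>f\<close> are the images of the coefficients over
  \<open>C\<close>, which is how \<open>C\<close> acts after restriction of scalars.\<close>

lemma derivation_comp: "cinf_derivation C (restrict_scalars f \<Omega>') (\<lambda>a. d' (f a))"
  unfolding cinf_derivation_def
proof (intro conjI allI impI ballI)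
  show "(\<lambda>a. d' (f a)) \<in> carrier C \<rightarrow> carrier (restrict_scalars f \<Omega>')"
    using d'_closed cinf_hom_closed[OF hom] by simp
  interpret \<Omega>': module "cinf_alg B" \<Omega>' by (rule cod.\<Omega>_module)
  interpret R: module "cinf_alg C" "restrict_scalars f \<Omega>'"
    by (rule module_restrict) (rule cod.\<Omega>_module)
  fix n :: nat and h xs assume n: "0 < n" and h: "h \<in> Cinf n"
    and xs: "set xs \<subseteq> carrier C \<and> length xs = n"
  define g where "g i = cinf_op B n (pd i h) (map f xs) \<odot>\<^bsub>\<Omega>'\<^esub> d' (f (xs ! i))" for i
  have fxs: "set (map f xs) \<subseteq> carrier B" "length (map f xs) = n"
    using xs cinf_hom_closed[OF hom] by auto
  have nth: "xs ! i \<in> carrier C" if "i < n" for i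
    using nth_mem[of i xs] that xs by blast
  have g: "g i \<in> carrier \<Omega>'" if "i < n" for i
    unfolding g_def using that fxs nth h
    by (intro \<Omega>'.smult_closed d'_closed cinf_hom_closed[OF hom])
      (simp_all add: cod.op_closed pd_Cinf)
  have "d' (f (cinf_op C n h xs)) = d' (cinf_op B n h (map f xs))"
    using cinf_hom_op[OF hom h] xs by simp
  also have "\<dots> = (\<Oplus>\<^bsub>\<Omega>'\<^esub>i\<in>{..<n}. cinf_op B n (pd i h) (map f xs) \<odot>\<^bsub>\<Omega>'\<^esub> d' (map f xs ! i))"
    using cinf_derivationD(2)[OF universal_derivationD(2)[OF cod_universal] n h fxs] .
  also have "\<dots> = (\<Oplus>\<^bsub>\<Omega>'\<^esub>i\<in>{..<n}. g i)"
    using xs g by (intro \<Omega>'.M.finsum_cong') (auto simp: g_def)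
  \<comment> \<open>Restriction of scalars does not change sums: the identity map is additive
    between the two modules.\<close>
  also have "\<dots> = (\<Oplus>\<^bsub>restrict_scalars f \<Omega>'\<^esub>i\<in>{..<n}. g i)"
    using g by (intro additive_finsum[where \<phi> = "\<lambda>x. x"] \<Omega>'.abelian_group_axioms
        R.abelian_group_axioms) auto
  also have "\<dots> = (\<Oplus>\<^bsub>restrict_scalars f \<Omega>'\<^esub>i\<in>{..<n}.
      cinf_op C n (pd i h) xs \<odot>\<^bsub>restrict_scalars f \<Omega>'\<^esub> d' (f (xs ! i)))"
    using xs g h by (intro R.M.finsum_cong') (auto simp: g_def cinf_hom_op[OF hom] pd_Cinf)
  finally show "d' (f (cinf_op C n h xs)) = (\<Oplus>\<^bsub>restrict_scalars f \<Omega>'\<^esub>i\<in>{..<n}.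
      cinf_op C n (pd i h) xs \<odot>\<^bsub>restrict_scalars f \<Omega>'\<^esub> d' (f (xs ! i)))" .
qed

text \<open>Applying \<open>\<phi>\<close> entrywise commutes with updating an entry and keeps equal
  entries equal, so the property is inherited from the products in
  \<open>\<Lambda>'\<close>.\<close>

lemma alternating_wedge_list_map:
  assumes \<phi>: "\<phi> \<in> linear_maps (cinf_alg C) \<Omega> (restrict_scalars f \<Omega>')"
  shows "alternating_multilinear (cinf_alg C) \<Omega> k (restrict_scalars f (piece \<Lambda>' (int k)))
    (\<lambda>xs. wedge_list B \<Lambda>' (map \<phi> xs))"
  unfolding alternating_multilinear_def
proof (intro allI impI conjI ballI)
  note alt = exterior_powerD(2)[OF cod.piece_exterior, unfolded alternating_multilinear_def, rule_format]
  fix xs assume "set xs \<subseteq> carrier \<Omega> \<and> length xs = k"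
  then have xs: "set (map \<phi> xs) \<subseteq> carrier \<Omega>'" "length (map \<phi> xs) = k"
    using linear_mapsD(2)[OF \<phi>] by auto
  note alt = alt[OF conjI[OF xs]]
  show "wedge_list B \<Lambda>' (map \<phi> xs) \<in> carrier (restrict_scalars f (piece \<Lambda>' (int k)))"
    using alt by simp
  { fix i x y assume "i < k" "x \<in> carrier \<Omega>" "y \<in> carrier \<Omega>"
    then show "wedge_list B \<Lambda>' (map \<phi> (xs[i := x \<oplus>\<^bsub>\<Omega>\<^esub> y])) =
        wedge_list B \<Lambda>' (map \<phi> (xs[i := x])) \<oplus>\<^bsub>restrict_scalars f (piece \<Lambda>' (int k))\<^esub>
        wedge_list B \<Lambda>' (map \<phi> (xs[i := y]))"
      using alt linear_mapsD(2,3)[OF \<phi>] by (simp add: map_update) }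
  { fix i r x assume "i < k" "r \<in> carrier (cinf_alg C)" "x \<in> carrier \<Omega>"
    then show "wedge_list B \<Lambda>' (map \<phi> (xs[i := r \<odot>\<^bsub>\<Omega>\<^esub> x])) =
        r \<odot>\<^bsub>restrict_scalars f (piece \<Lambda>' (int k))\<^esub> wedge_list B \<Lambda>' (map \<phi> (xs[i := x]))"
      using alt linear_mapsD(2,4)[OF \<phi>] cinf_hom_closed[OF hom] by (simp add: map_update) }
  fix i j assume "i < j \<and> j < k \<and> xs ! i = xs ! j"
  then have "i < j \<and> j < k \<and> map \<phi> xs ! i = map \<phi> xs ! j"
    using xs(2) by simp
  then have "wedge_list B \<Lambda>' (map \<phi> xs) = \<zero>\<^bsub>piece \<Lambda>' (int k)\<^esub>"
    using alt by blast
  then show "wedge_list B \<Lambda>' (map \<phi> xs) = \<zero>\<^bsub>restrict_scalars f (piece \<Lambda>' (int k))\<^esub>"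
    by simp
qed

text \<open>Apart from semilinearity, these conditions concern generators only, which makes them
  easy to construct and to show unique. They turn out to characterize the unital CDGA maps over
  \<open>f\<close>; unitality is the case of the empty list.\<close>

definition graded_map :: "(int \<Rightarrow> 'a \<Rightarrow> 'b) \<Rightarrow> bool" where
  "graded_map F \<longleftrightarrow>
    (\<forall>k. F k \<in> linear_maps (cinf_alg C) (piece \<Lambda> k) (restrict_scalars f (piece \<Lambda>' k))) \<and>
    (\<forall>a\<in>carrier C. F 1 (d a) = d' (f a)) \<and>
    (\<forall>xs. set xs \<subseteq> carrier \<Omega> \<longrightarrow>
      F (int (length xs)) (wedge_list C \<Lambda> xs) = wedge_list B \<Lambda>' (map (F 1) xs))"

lemma graded_mapD:
  assumes "graded_map F"
  shows "F k \<in> linear_maps (cinf_alg C) (piece \<Lambda> k) (restrict_scalars f (piece \<Lambda>' k))"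
    and "x \<in> carrier (piece \<Lambda> k) \<Longrightarrow> F k x \<in> carrier (piece \<Lambda>' k)"
    and "\<lbrakk>x \<in> carrier (piece \<Lambda> k); y \<in> carrier (piece \<Lambda> k)\<rbrakk>
      \<Longrightarrow> F k (x \<oplus>\<^bsub>piece \<Lambda> k\<^esub> y) = F k x \<oplus>\<^bsub>piece \<Lambda>' k\<^esub> F k y"
    and "\<lbrakk>r \<in> carrier C; x \<in> carrier (piece \<Lambda> k)\<rbrakk>
      \<Longrightarrow> F k (r \<odot>\<^bsub>piece \<Lambda> k\<^esub> x) = f r \<odot>\<^bsub>piece \<Lambda>' k\<^esub> F k x"
    and "F k \<zero>\<^bsub>piece \<Lambda> k\<^esub> = \<zero>\<^bsub>piece \<Lambda>' k\<^esub>"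
    and "x \<in> carrier (piece \<Lambda> k) \<Longrightarrow> F k (\<ominus>\<^bsub>piece \<Lambda> k\<^esub> x) = \<ominus>\<^bsub>piece \<Lambda>' k\<^esub> F k x"
    and "a \<in> carrier C \<Longrightarrow> F 1 (d a) = d' (f a)"
    and "set xs \<subseteq> carrier \<Omega> \<Longrightarrow>
      F (int (length xs)) (wedge_list C \<Lambda> xs) = wedge_list B \<Lambda>' (map (F 1) xs)"
proof -
  show lin: "F k \<in> linear_maps (cinf_alg C) (piece \<Lambda> k) (restrict_scalars f (piece \<Lambda>' k))" for k
    using assms by (simp add: graded_map_def)
  show cl: "F k x \<in> carrier (piece \<Lambda>' k)" if "x \<in> carrier (piece \<Lambda> k)" for x
    using linear_mapsD(2)[OF lin that] by simp
  show add: "F k (x \<oplus>\<^bsub>piece \<Lambda> k\<^esub> y) = F k x \<oplus>\<^bsub>piece \<Lambda>' k\<^esub> F k y"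
    if "x \<in> carrier (piece \<Lambda> k)" "y \<in> carrier (piece \<Lambda> k)" for x y
    using linear_mapsD(3)[OF lin that] by simp
  show "F k (r \<odot>\<^bsub>piece \<Lambda> k\<^esub> x) = f r \<odot>\<^bsub>piece \<Lambda>' k\<^esub> F k x"
    if "r \<in> carrier C" "x \<in> carrier (piece \<Lambda> k)"
    using linear_mapsD(4)[OF lin] that by simp
  show "F k \<zero>\<^bsub>piece \<Lambda> k\<^esub> = \<zero>\<^bsub>piece \<Lambda>' k\<^esub>"
    using cl add by (intro additive_zero dom.piece_abelian_group cod.piece_abelian_group) auto
  show "F k (\<ominus>\<^bsub>piece \<Lambda> k\<^esub> x) = \<ominus>\<^bsub>piece \<Lambda>' k\<^esub> F k x" if "x \<in> carrier (piece \<Lambda> k)"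
    using that cl add by (intro additive_minus dom.piece_abelian_group cod.piece_abelian_group) auto
  show "a \<in> carrier C \<Longrightarrow> F 1 (d a) = d' (f a)"
    "set xs \<subseteq> carrier \<Omega> \<Longrightarrow>
      F (int (length xs)) (wedge_list C \<Lambda> xs) = wedge_list B \<Lambda>' (map (F 1) xs)"
    using assms by (simp_all add: graded_map_def)
qed

lemma graded_map_exists: "\<exists>F. graded_map F"
proof -
  obtain \<phi> where \<phi>: "\<phi> \<in> linear_maps (cinf_alg C) \<Omega> (restrict_scalars f \<Omega>')"
    and \<phi>_d: "\<And>a. a \<in> carrier C \<Longrightarrow> \<phi> (d a) = d' (f a)"
    by (rule dom.universal_derivation_factor[OF dom_universal module_restrict[OF cod.\<Omega>_module] derivation_comp])
      blast
  \<comment> \<open>In each degree, the alternating map built from \<open>\<phi>\<close> factors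
    through the exterior power.\<close>
  have "\<exists>\<psi>. \<psi> \<in> linear_maps (cinf_alg C) (piece \<Lambda> (int k)) (restrict_scalars f (piece \<Lambda>' (int k))) \<and>
      (\<forall>xs. set xs \<subseteq> carrier \<Omega> \<and> length xs = k \<longrightarrow> \<psi> (wedge_list C \<Lambda> xs) = wedge_list B \<Lambda>' (map \<phi> xs))" for k
    by (rule exterior_power_factor[OF dom.piece_exterior dom.\<Omega>_module dom.infinite_or_zero_ring
          module_restrict[OF cod.piece_module] alternating_wedge_list_map[OF \<phi>]]) blast
  then obtain G where G: "\<And>k. G k \<in> linear_maps (cinf_alg C) (piece \<Lambda> (int k)) (restrict_scalars f (piece \<Lambda>' (int k)))"
    and G_wedge: "\<And>xs. set xs \<subseteq> carrier \<Omega> \<Longrightarrow> G (length xs) (wedge_list C \<Lambda> xs) = wedge_list B \<Lambda>' (map \<phi> xs)"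
    by metis
  \<comment> \<open>Negative degrees get the zero map, restricted so as to be extensional.\<close>
  define F where "F k = (if k \<ge> 0 then G (nat k)
    else restrict (\<lambda>_. \<zero>\<^bsub>piece \<Lambda>' k\<^esub>) (carrier (piece \<Lambda> k)))" for k
  have lin: "F k \<in> linear_maps (cinf_alg C) (piece \<Lambda> k) (restrict_scalars f (piece \<Lambda>' k))" for k
  proof (cases "k \<ge> 0")
    case True
    then show ?thesis using G[of "nat k"] by (simp add: F_def)
  next
    case False
    interpret M: module "cinf_alg C" "piece \<Lambda> k" by (rule dom.piece_module)
    interpret N: module "cinf_alg B" "piece \<Lambda>' k" by (rule cod.piece_module)
    show ?thesis
      using False cinf_hom_closed[OF hom] by (auto simp: F_def linear_maps_def)
  qed
  have F_wedge: "F (int (length xs)) (wedge_list C \<Lambda> xs) = wedge_list B \<Lambda>' (map \<phi> xs)"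
    if "set xs \<subseteq> carrier \<Omega>" for xs
    using G_wedge[OF that] by (simp add: F_def)
  \<comment> \<open>The component in degree 1 also came from an exterior power; one-element products
    identify it with \<open>\<phi>\<close>.\<close>
  have F_1: "F 1 x = \<phi> x" if "x \<in> carrier \<Omega>" for x
    using F_wedge[of "[x]"] that linear_mapsD(2)[OF \<phi>]
    by (simp add: dom.wedge_list_singleton cod.wedge_list_singleton del: wedge_list.simps)
  have "F (int (length xs)) (wedge_list C \<Lambda> xs) = wedge_list B \<Lambda>' (map (F 1) xs)"
    if "set xs \<subseteq> carrier \<Omega>" for xs
    using F_wedge[OF that] F_1 that by (simp add: subset_iff cong: map_cong)
  then have "graded_map F"
    using lin F_1 \<phi>_d d_closed unfolding graded_map_def by simp
  then show ?thesis by blast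
qed

section \<open>Compatibility with products and differentials\<close>

context
  fixes F assumes F: "graded_map F"
begin

text \<open>Write \<open>a\<close> as \<open>a\<close> times the unit: semilinearity extracts
  \<open>f a\<close>, and the unit, being the empty product, goes to the unit.\<close>

lemma graded_map_degree_0:
  assumes "a \<in> carrier C"
  shows "F 0 a = f a"
proof -
  interpret R: module "cinf_alg C" \<Omega> by (rule dom.\<Omega>_module)
  interpret S: module "cinf_alg B" \<Omega>' by (rule cod.\<Omega>_module)
  have "F 0 a = F 0 (a \<odot>\<^bsub>piece \<Lambda> 0\<^esub> \<one>\<^bsub>cinf_alg C\<^esub>)"
    using R.r_one[of a] assms dom.one_closed by (simp add: dom.smult_piece_0)
  also have "\<dots> = f a \<odot>\<^bsub>piece \<Lambda>' 0\<^esub> F 0 \<one>\<^bsub>cinf_alg C\<^esub>"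
    using assms dom.one_closed by (simp add: graded_mapD(4)[OF F] dom.carrier_piece_0)
  also have "F 0 \<one>\<^bsub>cinf_alg C\<^esub> = \<one>\<^bsub>cinf_alg B\<^esub>"
    using graded_mapD(8)[OF F, of "[]"] by simp
  also have "f a \<odot>\<^bsub>piece \<Lambda>' 0\<^esub> \<one>\<^bsub>cinf_alg B\<^esub> = f a"
    using S.r_one[of "f a"] assms cod.one_closed cinf_hom_closed[OF hom] by (simp add: cod.smult_piece_0)
  finally show ?thesis .
qed

lemma graded_map_degree_1: "x \<in> carrier \<Omega> \<Longrightarrow> F 1 x \<in> carrier \<Omega>'"
  using graded_mapD(2)[OF F, of x 1] by (simp add: dom.piece_1 cod.piece_1)

text \<open>Both sides are semilinear in each argument, so products of degree 1 elements suffice,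
  and there multiplication is concatenation. In negative degrees an argument is zero.\<close>

lemma graded_map_wedge:
  assumes x: "x \<in> carrier (piece \<Lambda> p)" and y: "y \<in> carrier (piece \<Lambda> q)"
  shows "F (p + q) (wedge \<Lambda> p q x y) = wedge \<Lambda>' p q (F p x) (F q y)"
proof (cases "p < 0 \<or> q < 0")
  case True
  then have "x = \<zero>\<^bsub>piece \<Lambda> p\<^esub> \<or> y = \<zero>\<^bsub>piece \<Lambda> q\<^esub>"
    using x y dom.piece_neg by blast
  then show ?thesis
    using x y graded_mapD(2,5)[OF F]
    by (auto simp: dom.wedge_zero_left dom.wedge_zero_right cod.wedge_zero_left cod.wedge_zero_right)
next
  case False
  then obtain m n where mn: "p = int m" "q = int n"
    using nonneg_int_cases by (metis not_less)
  interpret M: module "cinf_alg C" "piece \<Lambda> (int m)" by (rule dom.piece_module)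
  interpret N: module "cinf_alg C" "piece \<Lambda> (int n)" by (rule dom.piece_module)
  let ?N = "restrict_scalars f (piece \<Lambda>' (int m + int n))"
  have N: "module (cinf_alg C) ?N"
    by (rule module_restrict) (rule cod.piece_module)
  note simps = dom.wedge_add_left dom.wedge_add_right dom.wedge_smult_left dom.wedge_smult_right
    cod.wedge_add_left cod.wedge_add_right cod.wedge_smult_left cod.wedge_smult_right
    dom.wedge_closed cod.wedge_closed graded_mapD(2-4)[OF F] cinf_hom_closed[OF hom]
  have lists: "F (int m + int n) (wedge \<Lambda> (int m) (int n) (wedge_list C \<Lambda> xs) (wedge_list C \<Lambda> ys)) =
      wedge \<Lambda>' (int m) (int n) (F (int m) (wedge_list C \<Lambda> xs)) (F (int n) (wedge_list C \<Lambda> ys))"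
    if xs: "set xs \<subseteq> carrier \<Omega>" "length xs = m" and ys: "set ys \<subseteq> carrier \<Omega>" "length ys = n" for xs ys
  proof -
    have xs': "set (map (F 1) xs) \<subseteq> carrier \<Omega>'" and ys': "set (map (F 1) ys) \<subseteq> carrier \<Omega>'"
      using xs ys graded_map_degree_1 by auto
    have "F (int (length (xs @ ys))) (wedge_list C \<Lambda> (xs @ ys)) = wedge_list B \<Lambda>' (map (F 1) xs @ map (F 1) ys)"
      using graded_mapD(8)[OF F, of "xs @ ys"] xs ys by simp
    then show ?thesis
      using graded_mapD(8)[OF F xs(1)] graded_mapD(8)[OF F ys(1)] xs(2) ys(2)
        dom.wedge_list_append[OF xs(1) ys(1)] cod.wedge_list_append[OF xs' ys'] by simp
  qed
  \<comment> \<open>First the left argument is freed from being a product of degree 1 elements, with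
    the right one still such a product.\<close>
  have list: "F (int m + int n) (wedge \<Lambda> (int m) (int n) x (wedge_list C \<Lambda> ys)) =
      wedge \<Lambda>' (int m) (int n) (F (int m) x) (F (int n) (wedge_list C \<Lambda> ys))"
    if x: "x \<in> carrier (piece \<Lambda> (int m))" and ys: "set ys \<subseteq> carrier \<Omega>" "length ys = n" for x ys
  proof (rule dom.wedge_list_eqI[where x = x and
        \<alpha> = "\<lambda>x. F (int m + int n) (wedge \<Lambda> (int m) (int n) x (wedge_list C \<Lambda> ys))" and
        \<beta> = "\<lambda>x. wedge \<Lambda>' (int m) (int n) (F (int m) x) (F (int n) (wedge_list C \<Lambda> ys))",
        OF N _ _ lists[OF _ _ ys] x])
    have "wedge_list C \<Lambda> ys \<in> carrier (piece \<Lambda> (int n))"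
      using dom.wedge_list_closed[OF ys(1)] ys(2) by simp
    then show
      "(\<lambda>x\<in>carrier (piece \<Lambda> (int m)). F (int m + int n) (wedge \<Lambda> (int m) (int n) x (wedge_list C \<Lambda> ys)))
        \<in> linear_maps (cinf_alg C) (piece \<Lambda> (int m)) ?N"
      "(\<lambda>x\<in>carrier (piece \<Lambda> (int m)). wedge \<Lambda>' (int m) (int n) (F (int m) x) (F (int n) (wedge_list C \<Lambda> ys)))
        \<in> linear_maps (cinf_alg C) (piece \<Lambda> (int m)) ?N"
      by (auto simp: linear_maps_def simps)
  qed
  \<comment> \<open>Now the right argument is freed, with \<open>x\<close> arbitrary but
    fixed.\<close>
  have "F (int m + int n) (wedge \<Lambda> (int m) (int n) x y) =
      wedge \<Lambda>' (int m) (int n) (F (int m) x) (F (int n) y)"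
  proof (rule dom.wedge_list_eqI[where x = y and
        \<alpha> = "\<lambda>y. F (int m + int n) (wedge \<Lambda> (int m) (int n) x y)" and
        \<beta> = "\<lambda>y. wedge \<Lambda>' (int m) (int n) (F (int m) x) (F (int n) y)",
        OF N _ _ list y[unfolded mn(2)]])
    show "(\<lambda>y\<in>carrier (piece \<Lambda> (int n)). F (int m + int n) (wedge \<Lambda> (int m) (int n) x y))
        \<in> linear_maps (cinf_alg C) (piece \<Lambda> (int n)) ?N"
      "(\<lambda>y\<in>carrier (piece \<Lambda> (int n)). wedge \<Lambda>' (int m) (int n) (F (int m) x) (F (int n) y))
        \<in> linear_maps (cinf_alg C) (piece \<Lambda> (int n)) ?N"
      using x mn by (auto simp: linear_maps_def simps)
  qed (use x mn in auto)
  then show ?thesis using mn by simp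
qed

text \<open>Expanding both differentials by the Leibniz rule gives matching terms, since
  \<open>F\<close> preserves products and signs.\<close>

lemma graded_map_diff_wedge:
  assumes x: "x \<in> carrier (piece \<Lambda> p)" and y: "y \<in> carrier (piece \<Lambda> q)"
    and "F (p + 1) (diff \<Lambda> p x) = diff \<Lambda>' p (F p x)" "F (q + 1) (diff \<Lambda> q y) = diff \<Lambda>' q (F q y)"
  shows "F (p + q + 1) (diff \<Lambda> (p + q) (wedge \<Lambda> p q x y)) = diff \<Lambda>' (p + q) (F (p + q) (wedge \<Lambda> p q x y))"
proof -
  \<comment> \<open>The two Leibniz terms carry differently written degrees, which must become one
    index before they can be added.\<close>
  have shift: "p + 1 + q = p + q + 1" "p + (q + 1) = p + q + 1" by simp_all
  have 1: "wedge \<Lambda> (p + 1) q (diff \<Lambda> p x) y \<in> carrier (piece \<Lambda> (p + q + 1))"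
    "wedge \<Lambda> p (q + 1) x (diff \<Lambda> q y) \<in> carrier (piece \<Lambda> (p + q + 1))"
    "F (p + q + 1) (wedge \<Lambda> (p + 1) q (diff \<Lambda> p x) y) = wedge \<Lambda>' (p + 1) q (F (p + 1) (diff \<Lambda> p x)) (F q y)"
    "F (p + q + 1) (wedge \<Lambda> p (q + 1) x (diff \<Lambda> q y)) = wedge \<Lambda>' p (q + 1) (F p x) (F (q + 1) (diff \<Lambda> q y))"
    using dom.wedge_closed[OF dom.diff_closed[OF x] y] dom.wedge_closed[OF x dom.diff_closed[OF y]]
      graded_map_wedge[OF dom.diff_closed[OF x] y] graded_map_wedge[OF x dom.diff_closed[OF y]]
    by (simp_all only: shift)
  interpret M: abelian_group "piece \<Lambda> (p + q + 1)" by (rule dom.piece_abelian_group)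
  have "koszul_sign p (piece \<Lambda> (p + q + 1)) z \<in> carrier (piece \<Lambda> (p + q + 1))"
    "F (p + q + 1) (koszul_sign p (piece \<Lambda> (p + q + 1)) z) = koszul_sign p (piece \<Lambda>' (p + q + 1)) (F (p + q + 1) z)"
    if "z \<in> carrier (piece \<Lambda> (p + q + 1))" for z
    using that graded_mapD(6)[OF F] by (auto simp: koszul_sign_def)
  then show ?thesis
    using 1 x y assms(3,4) graded_mapD(2,3)[OF F]
    by (simp add: dom.diff_wedge cod.diff_wedge graded_map_wedge)
qed

lemma graded_map_diff_0: "a \<in> carrier C \<Longrightarrow> F (0 + 1) (diff \<Lambda> 0 a) = diff \<Lambda>' 0 (F 0 a)"
  using graded_mapD(7)[OF F] cinf_hom_closed[OF hom]
  by (simp add: dom.diff_degree_0 cod.diff_degree_0 graded_map_degree_0)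

text \<open>The differential is not linear over \<open>C\<close>, so
  \<open>equalizer_submodule\<close> does not apply. Closure under scalars comes from the Leibniz
  rule instead, with the scalar as a factor of degree 0.\<close>

lemma graded_map_diff_submodule:
  "submodule {x \<in> carrier (piece \<Lambda> k). F (k + 1) (diff \<Lambda> k x) = diff \<Lambda>' k (F k x)}
    (cinf_alg C) (piece \<Lambda> k)"
proof -
  interpret M: module "cinf_alg C" "piece \<Lambda> k" by (rule dom.piece_module)
  have "F (k + 1) (diff \<Lambda> k (r \<odot>\<^bsub>piece \<Lambda> k\<^esub> x)) = diff \<Lambda>' k (F k (r \<odot>\<^bsub>piece \<Lambda> k\<^esub> x))"
    if "r \<in> carrier C" "x \<in> carrier (piece \<Lambda> k)" "F (k + 1) (diff \<Lambda> k x) = diff \<Lambda>' k (F k x)" for r x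
    using graded_map_diff_wedge[of r 0 x k] graded_map_diff_0 that
    by (simp add: dom.carrier_piece_0 dom.wedge_degree_0)
  then show ?thesis
    using graded_mapD(2-5)[OF F]
    by (intro M.submoduleI_linear)
      (auto simp: dom.diff_zero cod.diff_zero dom.diff_add cod.diff_add dom.diff_closed)
qed

text \<open>On exact elements both sides vanish because \<open>d\<close> squares to zero, and the
  exact elements generate \<open>\<Omega>\<close>.\<close>

lemma graded_map_diff_1:
  assumes "x \<in> carrier \<Omega>"
  shows "F (1 + 1) (diff \<Lambda> 1 x) = diff \<Lambda>' 1 (F 1 x)"
proof -
  let ?H = "{x \<in> carrier (piece \<Lambda> 1). F (1 + 1) (diff \<Lambda> 1 x) = diff \<Lambda>' 1 (F 1 x)}"
  have "d a \<in> ?H" if a: "a \<in> carrier C" for a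
  proof -
    have "diff \<Lambda> 1 (d a) = \<zero>\<^bsub>piece \<Lambda> 2\<^esub>"
      using dom.diff_diff[of a 0] a by (simp add: dom.carrier_piece_0 dom.diff_degree_0)
    moreover have "diff \<Lambda>' 1 (d' (f a)) = \<zero>\<^bsub>piece \<Lambda>' 2\<^esub>"
      using cod.diff_diff[of "f a" 0] cinf_hom_closed[OF hom a]
      by (simp add: cod.carrier_piece_0 cod.diff_degree_0)
    ultimately show ?thesis
      using graded_mapD(5,7)[OF F] d_closed a by (simp add: dom.piece_1)
  qed
  then have "?H = carrier \<Omega>"
    using dom.universal_derivation_generated[OF dom_universal] graded_map_diff_submodule[of 1]
    unfolding dom.piece_1 by blast
  then show ?thesis
    using assms by blast
qed

text \<open>The Leibniz rule propagates the identity from degrees 0 and 1 to all products by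
  induction on the list; these products generate each piece of nonnegative degree.\<close>

lemma graded_map_diff:
  assumes x: "x \<in> carrier (piece \<Lambda> k)"
  shows "F (k + 1) (diff \<Lambda> k x) = diff \<Lambda>' k (F k x)"
proof (cases "k < 0")
  case True
  then have "x = \<zero>\<^bsub>piece \<Lambda> k\<^esub>"
    using x dom.piece_neg by blast
  then show ?thesis
    using graded_mapD(5)[OF F] by (simp add: dom.diff_zero cod.diff_zero)
next
  case False
  then obtain n where n: "k = int n"
    using nonneg_int_cases by (metis not_less)
  have "F (int (length xs) + 1) (diff \<Lambda> (int (length xs)) (wedge_list C \<Lambda> xs)) =
      diff \<Lambda>' (int (length xs)) (F (int (length xs)) (wedge_list C \<Lambda> xs))"
    if "set xs \<subseteq> carrier \<Omega>" for xs
    using that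
  proof (induction xs)
    case Nil
    then show ?case
      using graded_map_diff_0[OF dom.one_closed] by simp
  next
    case (Cons x xs)
    then show ?case
      using graded_map_diff_wedge[of x 1 "wedge_list C \<Lambda> xs" "int (length xs)"] graded_map_diff_1
      by (simp add: dom.piece_1 dom.wedge_list_closed)
  qed
  then have "{x \<in> carrier (piece \<Lambda> (int n)). F (int n + 1) (diff \<Lambda> (int n) x) = diff \<Lambda>' (int n) (F (int n) x)} =
      carrier (piece \<Lambda> (int n))"
    using dom.wedge_list_closed by (intro dom.wedge_list_generated graded_map_diff_submodule) blast
  then show ?thesis
    using x n by blast
qed

lemma graded_map_cdga_map: "cdga_map C \<Lambda> B \<Lambda>' (f, F)"
proof -
  have "F k \<in> carrier (piece \<Lambda> k) \<rightarrow>\<^sub>E carrier (piece \<Lambda>' k)" for k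
    using graded_mapD(1)[OF F] by (auto simp: linear_maps_def)
  then show ?thesis
    unfolding cdga_map_def
    using hom graded_mapD(3,4)[OF F] graded_map_wedge graded_map_diff by simp
qed

lemma graded_map_unital: "F 0 \<one>\<^bsub>cinf_alg C\<^esub> = \<one>\<^bsub>cinf_alg B\<^esub>"
  using graded_mapD(8)[OF F, of "[]"] by simp

lemma graded_map_formula:
  assumes "a \<in> carrier C" "set as \<subseteq> carrier C"
  shows "F (int (length as)) (a \<odot>\<^bsub>piece \<Lambda> (int (length as))\<^esub> wedge_list C \<Lambda> (map d as)) =
    f a \<odot>\<^bsub>piece \<Lambda>' (int (length as))\<^esub> wedge_list B \<Lambda>' (map (\<lambda>a. d' (f a)) as)"
proof -
  have das: "set (map d as) \<subseteq> carrier \<Omega>"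
    using assms(2) d_closed by auto
  have eq: "map (F 1) (map d as) = map (\<lambda>a. d' (f a)) as"
    using assms(2) graded_mapD(7)[OF F] by auto
  show ?thesis
    using graded_mapD(4)[OF F assms(1) dom.wedge_list_closed[OF das]] graded_mapD(8)[OF F das]
    unfolding eq length_map by simp
qed

end

text \<open>Unitality starts the induction over products and, with semilinearity, forces
  \<open>F 0\<close> to be \<open>f\<close>. Commuting with the differential in degree 0 then
  determines \<open>F 1\<close> on exact elements.\<close>

lemma cdga_map_graded_map:
  assumes F: "cdga_map C \<Lambda> B \<Lambda>' (f, F)" and one: "F 0 \<one>\<^bsub>cinf_alg C\<^esub> = \<one>\<^bsub>cinf_alg B\<^esub>"
  shows "graded_map F"
proof -
  have lin: "F k \<in> linear_maps (cinf_alg C) (piece \<Lambda> k) (restrict_scalars f (piece \<Lambda>' k))" for k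
    using F by (simp add: cdga_map_def linear_maps_def)
  have wedge: "F (p + q) (wedge \<Lambda> p q x y) = wedge \<Lambda>' p q (F p x) (F q y)"
    if "x \<in> carrier (piece \<Lambda> p)" "y \<in> carrier (piece \<Lambda> q)" for p q x y
    using F that by (simp add: cdga_map_def)
  have diff: "F (k + 1) (diff \<Lambda> k x) = diff \<Lambda>' k (F k x)" if "x \<in> carrier (piece \<Lambda> k)" for k x
    using F that by (simp add: cdga_map_def)
  have lists: "F (int (length xs)) (wedge_list C \<Lambda> xs) = wedge_list B \<Lambda>' (map (F 1) xs)"
    if "set xs \<subseteq> carrier \<Omega>" for xs
    using that
  proof (induction xs)
    case Nil
    then show ?case using one by simp
  next
    case (Cons x xs)
    then show ?case
      using wedge[of x 1 "wedge_list C \<Lambda> xs" "int (length xs)"]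
      by (simp add: dom.piece_1 dom.wedge_list_closed)
  qed
  have F_0: "F 0 a = f a" if a: "a \<in> carrier C" for a
  proof -
    interpret R: module "cinf_alg C" \<Omega> by (rule dom.\<Omega>_module)
    interpret S: module "cinf_alg B" \<Omega>' by (rule cod.\<Omega>_module)
    have "F 0 (a \<odot>\<^bsub>piece \<Lambda> 0\<^esub> \<one>\<^bsub>cinf_alg C\<^esub>) = f a \<odot>\<^bsub>piece \<Lambda>' 0\<^esub> \<one>\<^bsub>cinf_alg B\<^esub>"
      using linear_mapsD(4)[OF lin, of a "\<one>\<^bsub>cinf_alg C\<^esub>" 0] a dom.one_closed one
      by (simp add: dom.carrier_piece_0)
    then show ?thesis
      using R.r_one[of a] S.r_one[of "f a"] a dom.one_closed cod.one_closed cinf_hom_closed[OF hom]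
      by (simp add: dom.smult_piece_0 cod.smult_piece_0)
  qed
  have "F 1 (d a) = d' (f a)" if "a \<in> carrier C" for a
    using diff[of a 0] F_0 that cinf_hom_closed[OF hom]
    by (simp add: dom.carrier_piece_0 dom.diff_degree_0 cod.diff_degree_0)
  then show ?thesis
    using lin lists by (simp add: graded_map_def)
qed

text \<open>Agreement spreads from exact elements to \<open>\<Omega>\<close>, then to products, then
  to the pieces they generate. Outside the carriers both maps are \<open>undefined\<close>, so they
  are equal as functions.\<close>

lemma graded_map_unique:
  assumes F: "graded_map F" and G: "graded_map G"
  shows "F = G"
proof
  fix k
  have restrict: "restrict (H k) (carrier (piece \<Lambda> k)) = H k" if "graded_map H" for H k
    using restrict_linear_map[OF graded_mapD(1)[OF that]] .
  have N: "module (cinf_alg C) (restrict_scalars f (piece \<Lambda>' k))" for k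
    by (rule module_restrict) (rule cod.piece_module)
  have "{x \<in> carrier (piece \<Lambda> 1). F 1 x = G 1 x} = carrier \<Omega>"
  proof (rule dom.universal_derivation_generated[OF dom_universal])
    show "submodule {x \<in> carrier (piece \<Lambda> 1). F 1 x = G 1 x} (cinf_alg C) \<Omega>"
      using equalizer_submodule[OF dom.piece_module N, of "F 1" 1 1 "G 1"]
        graded_mapD(1)[OF F, of 1] graded_mapD(1)[OF G, of 1] restrict[OF F, of 1] restrict[OF G, of 1]
      by (simp add: dom.piece_1)
    show "d ` carrier C \<subseteq> {x \<in> carrier (piece \<Lambda> 1). F 1 x = G 1 x}"
      using graded_mapD(7)[OF F] graded_mapD(7)[OF G] d_closed by (auto simp: dom.piece_1)
  qed
  then have 1: "map (F 1) xs = map (G 1) xs" if "set xs \<subseteq> carrier \<Omega>" for xs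
    using that by auto
  have "F k x = G k x" if x: "x \<in> carrier (piece \<Lambda> k)" for x
  proof (cases "k < 0")
    case True
    then have "x = \<zero>\<^bsub>piece \<Lambda> k\<^esub>"
      using x dom.piece_neg by blast
    then show ?thesis
      using graded_mapD(5)[OF F] graded_mapD(5)[OF G] by simp
  next
    case False
    then obtain n where n: "k = int n"
      using nonneg_int_cases by (metis not_less)
    have "F (int n) x = G (int n) x"
    proof (rule dom.wedge_list_eqI[OF N])
      show "F (int n) (wedge_list C \<Lambda> xs) = G (int n) (wedge_list C \<Lambda> xs)"
        if "set xs \<subseteq> carrier \<Omega>" "length xs = n" for xs
        using graded_mapD(8)[OF F that(1)] graded_mapD(8)[OF G that(1)] 1[OF that(1)] that(2) by simp
    qed (use graded_mapD(1)[OF F] graded_mapD(1)[OF G] restrict[OF F] restrict[OF G] x n in auto)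
    then show ?thesis using n by simp
  qed
  then have "restrict (F k) (carrier (piece \<Lambda> k)) = restrict (G k) (carrier (piece \<Lambda> k))"
    by (rule restrict_ext)
  then show "F k = G k"
    using restrict[OF F] restrict[OF G] by simp
qed

end

theorem proposition4p4:
  fixes C :: "'a cinf_ring" and \<Omega>\<^sub>C :: "('a, 'a) module" and d\<^sub>C :: "'a \<Rightarrow> 'a"
    and \<Lambda>\<^sub>C :: "('a, 'a) cdga_data"
    and B :: "'b cinf_ring" and \<Omega>\<^sub>B :: "('b, 'b) module" and d\<^sub>B :: "'b \<Rightarrow> 'b"
    and \<Lambda>\<^sub>B :: "('b, 'b) cdga_data"
    and f :: "'a \<Rightarrow> 'b"
  assumes "cinf_ring C" and "universal_derivation C \<Omega>\<^sub>C d\<^sub>C" and "exterior_cdga C \<Lambda>\<^sub>C \<Omega>\<^sub>C d\<^sub>C"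
    and "cinf_ring B" and "universal_derivation B \<Omega>\<^sub>B d\<^sub>B" and "exterior_cdga B \<Lambda>\<^sub>B \<Omega>\<^sub>B d\<^sub>B"
    and "f \<in> cinf_hom C B"
  shows "(\<exists>!F. cdga_map C \<Lambda>\<^sub>C B \<Lambda>\<^sub>B (f, F) \<and> F 0 \<one>\<^bsub>cinf_alg C\<^esub> = \<one>\<^bsub>cinf_alg B\<^esub>) \<and>
    (\<forall>F. cdga_map C \<Lambda>\<^sub>C B \<Lambda>\<^sub>B (f, F) \<and> F 0 \<one>\<^bsub>cinf_alg C\<^esub> = \<one>\<^bsub>cinf_alg B\<^esub> \<longrightarrow>
      (\<forall>k>0. \<forall>a\<^sub>0\<in>carrier C. \<forall>as. set as \<subseteq> carrier C \<and> length as = k \<longrightarrow>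
        F (int k) (a\<^sub>0 \<odot>\<^bsub>piece \<Lambda>\<^sub>C (int k)\<^esub> wedge_list C \<Lambda>\<^sub>C (map d\<^sub>C as)) =
        f a\<^sub>0 \<odot>\<^bsub>piece \<Lambda>\<^sub>B (int k)\<^esub> wedge_list B \<Lambda>\<^sub>B (map (\<lambda>a. d\<^sub>B (f a)) as)))"
proof -
  interpret exterior_cdga_hom C \<Lambda>\<^sub>C \<Omega>\<^sub>C d\<^sub>C B \<Lambda>\<^sub>B \<Omega>\<^sub>B d\<^sub>B f
    using assms by (intro exterior_cdga_hom.intro exterior_cdga_hom_axioms.intro)
  \<comment> \<open>Through this equivalence, existence, uniqueness and the explicit formula become
    the statements shown for \<open>graded_map\<close>.\<close>
  have iff: "cdga_map C \<Lambda>\<^sub>C B \<Lambda>\<^sub>B (f, F) \<and> F 0 \<one>\<^bsub>cinf_alg C\<^esub> = \<one>\<^bsub>cinf_alg B\<^esub> \<longleftrightarrow> graded_map F" for F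
    using cdga_map_graded_map graded_map_cdga_map graded_map_unital by blast
  show ?thesis
    unfolding iff using graded_map_exists graded_map_unique graded_map_formula by blast
qed

end
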